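(* Let $\mathcal F|\mathcal K$ be a finitely generated field extension and $P$ a place of $\mathcal F$ (not necessarily the identity on $\mathcal K$). Assume that $(\mathcal F|\mathcal K,P)$ is weakly uniformizable. Then $(\mathcal F|\mathcal K,P)$ is inertially generated. In particular, $\mathcal F|\mathcal K$ is separable. If in addition $P$ is the identity on $\mathcal K$ and $\mathcal FP=\mathcal K$, then $(\mathcal F|\mathcal K,P)$ is even henselian generated.
   Context: $\mathcal O_{\mathcal F}$, $\mathcal O_{\mathcal K}$ denote the valuation rings of $P$ on $\mathcal F$, $\mathcal K$; $aP$ is the residue of $a$ and $\mathcal FP$ the residue field. $(\mathcal F|\mathcal K,P)$ is weakly uniformizable if there are a transcendence basis $T=\{t_1,\ldots,t_s\}\subset\mathcal O_{\mathcal F}$ of $\mathcal F|\mathcal K$ (possibly empty), elements $\eta_1,\ldots,\eta_n\in\mathcal O_{\mathcal F}$, and polynomials $f_i\in\mathcal O_{\mathcal K}[t_1,\ldots,t_s,X_1,\ldots,X_n]$, $1\le i\le n$, such that $\mathcal F=\mathcal K(t_1,\ldots,t_s,\eta_1,\ldots,\eta_n)$ and: (U1) for $i<j$, $X_j$ does not occur in $f_i$; (U2) $f_i(\eta_1,\ldots,\eta_n)=0$ for $1\le i\le n$; (U3) $(\det J_f(\eta_1,\ldots,\eta_n))P\neq 0$, where $J_f=(\partial f_i/\partial X_j)_{i,j}$. For a valued field $(L,P)$ and an extension of $P$ to the separable-algebraic closure $L^{\rm sep}$, the absolute inertia field of $(L,P)$ is the inertia field, and the henselization is the decomposition field, of $(L^{\rm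 sep}|L,P)$. $(\mathcal F|\mathcal K,P)$ is inertially generated (respectively henselian generated) if it admits a transcendence basis $T$ such that $(\mathcal F,P)$ lies in the absolute inertia field (respectively the henselization) of $(\mathcal K(T),P)$ for some extension of $P$ to $\mathcal K(T)^{\rm sep}$. "Separable" for a not necessarily algebraic extension means linearly disjoint from every purely inseparable extension of the ground field. *)

theory Defs
  imports
    "HOL-Library.Poly_Mapping"
    "HOL-Algebra.Algebraic_Closure_Type"
    "Jordan_Normal_Form.Determinant"
begin

section \<open>Subrings and subfields of a field\<close>

definition is_subring :: "'a::field set \<Rightarrow> bool" where
  "is_subring R \<longleftrightarrow> 1 \<in> R \<and> (\<forall>x\<in>R. \<forall>y\<in>R. x - y \<in> R \<and> x * y \<in> R)"

definition is_subfield :: "'a::field set \<Rightarrow> bool" where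
  "is_subfield K \<longleftrightarrow> is_subring K \<and> (\<forall>x\<in>K. inverse x \<in> K)"

definition ring_adjoin :: "'a::field set \<Rightarrow> 'a set \<Rightarrow> 'a set" where
  "ring_adjoin R S = is_subring hull (R \<union> S)"

definition field_adjoin :: "'a::field set \<Rightarrow> 'a set \<Rightarrow> 'a set" where
  "field_adjoin K S = is_subfield hull (K \<union> S)"

text \<open>The field \<open>\<F>\<close> is the universe of the type \<open>'a\<close>; the ground field is a subfield \<open>K\<close> of it.\<close>

definition finitely_generated_over :: "'a::field set \<Rightarrow> bool" where
  "finitely_generated_over K \<longleftrightarrow> (\<exists>S. finite S \<and> field_adjoin K S = UNIV)"


section \<open>Multivariate polynomials\<close>

text \<open>A polynomial in variables indexed by \<open>'v\<close> maps monomials (finitely supported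
  exponent functions) to coefficients.\<close>

type_synonym ('v, 'a) mpol = "('v \<Rightarrow>\<^sub>0 nat) \<Rightarrow>\<^sub>0 'a"

definition mpol_over :: "'a::field set \<Rightarrow> 'v set \<Rightarrow> ('v, 'a) mpol set" where
  "mpol_over R V =
     {p. (\<forall>m. Poly_Mapping.lookup p m \<in> R) \<and>
         (\<forall>m\<in>Poly_Mapping.keys p. Poly_Mapping.keys m \<subseteq> V)}"

definition mpol_eval :: "('v, 'a::field) mpol \<Rightarrow> ('v \<Rightarrow> 'a) \<Rightarrow> 'a" where
  "mpol_eval p g =
     (\<Sum>m\<in>Poly_Mapping.keys p.
        Poly_Mapping.lookup p m * (\<Prod>v\<in>Poly_Mapping.keys m. g v ^ Poly_Mapping.lookup m v))"

definition occurs_in :: "'v \<Rightarrow> ('v, 'a::field) mpol \<Rightarrow> bool" where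
  "occurs_in v p \<longleftrightarrow> (\<exists>m\<in>Poly_Mapping.keys p. v \<in> Poly_Mapping.keys m)"

definition partial_deriv :: "'v \<Rightarrow> ('v, 'a::field) mpol \<Rightarrow> ('v, 'a) mpol" where
  "partial_deriv v p =
     (\<Sum>m\<in>Poly_Mapping.keys p. Poly_Mapping.single (m - Poly_Mapping.single v 1)
                    (of_nat (Poly_Mapping.lookup m v) * Poly_Mapping.lookup p m))"

definition jacobian_at :: "nat \<Rightarrow> (nat \<Rightarrow> (nat, 'a::field) mpol) \<Rightarrow> (nat \<Rightarrow> 'a) \<Rightarrow> 'a mat" where
  "jacobian_at n f \<eta> = mat n n (\<lambda>(i, j). mpol_eval (partial_deriv j (f i)) \<eta>)"


section \<open>Algebraic, separable and transcendental extensions\<close>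

definition algebraic_over_subfield :: "'a::field set \<Rightarrow> 'a \<Rightarrow> bool" where
  "algebraic_over_subfield K x \<longleftrightarrow>
     (\<exists>p. p \<noteq> 0 \<and> (\<forall>i. poly.coeff p i \<in> K) \<and> poly p x = 0)"

text \<open>The variables of the polynomials are the elements of \<open>T\<close> themselves.\<close>

definition algebraically_independent :: "'a::field set \<Rightarrow> 'a set \<Rightarrow> bool" where
  "algebraically_independent K T \<longleftrightarrow>
     (\<forall>p\<in>mpol_over K T. mpol_eval p (\<lambda>t. t) = 0 \<longrightarrow> p = 0)"

definition transcendence_basis :: "'a::field set \<Rightarrow> 'a set \<Rightarrow> bool" where
  "transcendence_basis K T \<longleftrightarrow>
     algebraically_independent K T \<and> (\<forall>x. algebraic_over_subfield (field_adjoin K T) x)"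

definition is_min_poly :: "'a::field set \<Rightarrow> 'a \<Rightarrow> 'a poly \<Rightarrow> bool" where
  "is_min_poly K x p \<longleftrightarrow>
     Polynomial.lead_coeff p = 1 \<and> (\<forall>i. poly.coeff p i \<in> K) \<and> poly p x = 0 \<and>
     (\<forall>q. q \<noteq> 0 \<and> (\<forall>i. poly.coeff q i \<in> K) \<and> poly q x = 0 \<longrightarrow>
          Polynomial.degree p \<le> Polynomial.degree q)"

text \<open>As the ambient field is algebraically closed, \<^const>\<open>rsquarefree\<close> says that
  the minimal polynomial has no multiple roots in any extension field.\<close>

definition separable_over_subfield :: "'b::alg_closed_field set \<Rightarrow> 'b \<Rightarrow> bool" where
  "separable_over_subfield L x \<longleftrightarrow> (\<exists>p. is_min_poly L x p \<and> rsquarefree p)"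

definition sep_closure :: "'b::alg_closed_field set \<Rightarrow> 'b set" where
  "sep_closure L = {x. separable_over_subfield L x}"

text \<open>\<open>max 1 CHAR('a)\<close> is the characteristic exponent.\<close>

definition purely_inseparable :: "'a::field set \<Rightarrow> 'a set \<Rightarrow> bool" where
  "purely_inseparable K E \<longleftrightarrow> is_subfield E \<and> K \<subseteq> E \<and>
     (\<forall>x\<in>E. \<exists>n. x ^ (max 1 CHAR('a) ^ n) \<in> K)"

definition lin_indep_over :: "'a::field set \<Rightarrow> 'a set \<Rightarrow> bool" where
  "lin_indep_over K S \<longleftrightarrow>
     (\<forall>c. (\<forall>x\<in>S. c x \<in> K) \<and> (\<Sum>x\<in>S. c x * x) = 0 \<longrightarrow> (\<forall>x\<in>S. c x = 0))"

definition linearly_disjoint :: "'a::field set \<Rightarrow> 'a set \<Rightarrow> 'a set \<Rightarrow> bool" where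
  "linearly_disjoint K A E \<longleftrightarrow>
     (\<forall>S. finite S \<and> S \<subseteq> A \<and> lin_indep_over K S \<longrightarrow> lin_indep_over E S)"

text \<open>Every purely inseparable extension of \<open>K\<close> embeds over \<open>K\<close>, uniquely, into
  the algebraic closure of \<open>\<F>\<close>, where linear disjointness from \<open>\<F>\<close> is then tested.\<close>

definition separable_extension :: "'a::field set \<Rightarrow> bool" where
  "separable_extension K \<longleftrightarrow>
     (\<forall>E. purely_inseparable (to_ac ` K) E \<longrightarrow>
          linearly_disjoint (to_ac ` K) (range to_ac) E)"


section \<open>Places\<close>

text \<open>A place takes values in a field together with \<open>\<infinity>\<close>, which is represented by
  \<^const>\<open>None\<close>. Values of \<open>P\<close> outside \<open>L\<close> are irrelevant.\<close>

definition valuation_ring :: "'a::field set \<Rightarrow> ('a \<Rightarrow> 'k::field option) \<Rightarrow> 'a set" where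
  "valuation_ring L P = {x\<in>L. P x \<noteq> None}"

definition residue :: "('a::field \<Rightarrow> 'k::field option) \<Rightarrow> 'a \<Rightarrow> 'k" where
  "residue P x = the (P x)"

definition residue_field :: "'a::field set \<Rightarrow> ('a \<Rightarrow> 'k::field option) \<Rightarrow> 'k set" where
  "residue_field L P = residue P ` valuation_ring L P"

definition place_on :: "'a::field set \<Rightarrow> ('a \<Rightarrow> 'k::field option) \<Rightarrow> bool" where
  "place_on L P \<longleftrightarrow> is_subfield L \<and> P 1 = Some 1 \<and>
     (\<forall>x\<in>valuation_ring L P. \<forall>y\<in>valuation_ring L P.
        P (x + y) = Some (residue P x + residue P y) \<and>
        P (x * y) = Some (residue P x * residue P y)) \<and>
     (\<forall>x\<in>L. P x = None \<longrightarrow> P (inverse x) = Some 0)"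

text \<open>\<open>\<iota>\<close> is the inclusion along which \<open>K\<close> is regarded as a subfield of the residue
  field; being the restriction of a place that is finite on \<open>K\<close>, it is an embedding.\<close>

definition place_identity_on :: "('a::field \<Rightarrow> 'k::field) \<Rightarrow> 'a set \<Rightarrow> ('a \<Rightarrow> 'k option) \<Rightarrow> bool" where
  "place_identity_on \<iota> K P \<longleftrightarrow> (\<forall>c\<in>K. P c = Some (\<iota> c))"


section \<open>Decomposition and inertia fields\<close>

text \<open>Only the values of an automorphism on \<open>N\<close> matter.\<close>

definition galois_group :: "'b::field set \<Rightarrow> 'b set \<Rightarrow> ('b \<Rightarrow> 'b) set" where
  "galois_group N L = {\<sigma>. bij_betw \<sigma> N N \<and>
     (\<forall>x\<in>N. \<forall>y\<in>N. \<sigma> (x + y) = \<sigma> x + \<sigma> y \<and> \<sigma> (x * y) = \<sigma> x * \<sigma> y) \<and>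
     (\<forall>x\<in>L. \<sigma> x = x)}"

definition decomposition_group ::
  "'b::field set \<Rightarrow> 'b set \<Rightarrow> ('b \<Rightarrow> 'k::field option) \<Rightarrow> ('b \<Rightarrow> 'b) set" where
  "decomposition_group N L Q =
     {\<sigma>\<in>galois_group N L. \<sigma> ` valuation_ring N Q = valuation_ring N Q}"

definition inertia_group ::
  "'b::field set \<Rightarrow> 'b set \<Rightarrow> ('b \<Rightarrow> 'k::field option) \<Rightarrow> ('b \<Rightarrow> 'b) set" where
  "inertia_group N L Q =
     {\<sigma>\<in>galois_group N L. \<forall>x\<in>valuation_ring N Q. Q (\<sigma> x - x) = Some 0}"

definition fixed_field :: "'b set \<Rightarrow> ('b \<Rightarrow> 'b) set \<Rightarrow> 'b set" where
  "fixed_field N G = {x\<in>N. \<forall>\<sigma>\<in>G. \<sigma> x = x}"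

definition absolute_inertia_field ::
  "'b::alg_closed_field set \<Rightarrow> ('b \<Rightarrow> 'k::field option) \<Rightarrow> 'b set" where
  "absolute_inertia_field L Q = fixed_field (sep_closure L) (inertia_group (sep_closure L) L Q)"

definition henselization ::
  "'b::alg_closed_field set \<Rightarrow> ('b \<Rightarrow> 'k::field option) \<Rightarrow> 'b set" where
  "henselization L Q = fixed_field (sep_closure L) (decomposition_group (sep_closure L) L Q)"


section \<open>Uniformizability and generation\<close>

text \<open>\<open>T\<close> is algebraically independent, so the polynomial ring \<open>\<O>\<^sub>K[t\<^sub>1,\<dots>,t\<^sub>s]\<close> is the
  subring \<open>ring_adjoin (valuation_ring K P) T\<close> of \<open>\<F>\<close>. Indices run from \<open>0\<close> to \<open>n - 1\<close>,
  and \<open>n = 0\<close> is allowed.\<close>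

definition weakly_uniformizable :: "'a::field set \<Rightarrow> ('a \<Rightarrow> 'k::field option) \<Rightarrow> bool" where
  "weakly_uniformizable K P \<longleftrightarrow>
     (\<exists>T n \<eta> f.
        finite T \<and> T \<subseteq> valuation_ring UNIV P \<and> transcendence_basis K T \<and>
        \<eta> ` {..<n} \<subseteq> valuation_ring UNIV P \<and>
        (\<forall>i<n. f i \<in> mpol_over (ring_adjoin (valuation_ring K P) T) {..<n}) \<and>
        field_adjoin K (T \<union> \<eta> ` {..<n}) = UNIV \<and>
        (\<forall>i j. i < j \<and> j < n \<longrightarrow> \<not> occurs_in j (f i)) \<and>
        (\<forall>i<n. mpol_eval (f i) \<eta> = 0) \<and>
        P (det (jacobian_at n f \<eta>)) \<noteq> Some 0)"

text \<open>If \<open>T\<close> is a transcendence basis, then the algebraic closure of \<open>\<F>\<close> is one of \<open>K(T)\<close>,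
  and \<open>K(T)\<close> has its separable-algebraic closure there. The residue field of an extension
  \<open>Q\<close> of \<open>P\<close> to it is algebraic over that of \<open>P\<close>, so \<open>Q\<close> may take its values in the
  algebraic closure of \<open>'k\<close>. That \<open>Q\<close> agrees with \<open>P\<close> on \<open>\<F>\<close>, not merely
  on \<open>K(T)\<close>, makes the inclusions below inclusions of valued fields.\<close>

definition place_extends ::
  "('a::field alg_closure \<Rightarrow> 'k::field alg_closure option) \<Rightarrow> ('a \<Rightarrow> 'k option) \<Rightarrow> bool" where
  "place_extends Q P \<longleftrightarrow> (\<forall>x. Q (to_ac x) = map_option to_ac (P x))"

definition inertially_generated :: "'a::field set \<Rightarrow> ('a \<Rightarrow> 'k::field option) \<Rightarrow> bool" where
  "inertially_generated K P \<longleftrightarrow>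
     (\<exists>T (Q :: 'a alg_closure \<Rightarrow> 'k alg_closure option).
        transcendence_basis K T \<and>
        place_on (sep_closure (to_ac ` field_adjoin K T)) Q \<and> place_extends Q P \<and>
        range to_ac \<subseteq> absolute_inertia_field (to_ac ` field_adjoin K T) Q)"

definition henselian_generated :: "'a::field set \<Rightarrow> ('a \<Rightarrow> 'k::field option) \<Rightarrow> bool" where
  "henselian_generated K P \<longleftrightarrow>
     (\<exists>T (Q :: 'a alg_closure \<Rightarrow> 'k alg_closure option).
        transcendence_basis K T \<and>
        place_on (sep_closure (to_ac ` field_adjoin K T)) Q \<and> place_extends Q P \<and>
        range to_ac \<subseteq> henselization (to_ac ` field_adjoin K T) Q)"

end

theory Submission
  imports Defs
begin

text \<open>
  The triangular shape of the Jacobian matrix makes the system a tower of simple extensions: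
  \<open>\<eta>\<^sub>i\<close> is a root of a polynomial over the valuation ring of \<open>K(T, \<eta>\<^sub>0, \<dots>)\<close> whose derivative
  at \<open>\<eta>\<^sub>i\<close> has nonzero residue. An automorphism over \<open>K(T)\<close> that acts trivially on the residue
  field of \<open>\<F>\<close> therefore fixes each \<open>\<eta>\<^sub>i\<close>. This applies to the inertia group and, if
  \<open>\<F>P = K\<close>, to the whole decomposition group. Separability, both of \<open>\<F>|K\<close> and of
  the elements of \<open>\<F>\<close> over \<open>K(T)\<close>, comes from MacLane's criterion: linear disjointness from
  the purely inseparable extensions passes through purely transcendental extensions and through
  simple separable ones. The place is extended to the algebraic closure by a maximal
  homomorphism from a subring to the algebraic closure of the residue field.
\<close>

section \<open>Subrings and subfields\<close>

text \<open>The inertia field and the henselization lie inside the separable closure of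
  \<open>K(T)\<close>, so every element of the field must be known to be separable over
  \<open>K(T)\<close> before any automorphism is considered. The tower shows this only for its
  generators, each over the stage below. To pass to all elements, and even to see that
  \<open>sep_closure\<close> is a field, separability has to be transitive. Linear disjointness from
  \<open>q\<close>-th roots, with \<open>q\<close> a power of the characteristic exponent, is
  transitive directly from its definition, and it also covers the transcendental step from
  \<open>K\<close> to \<open>K(T)\<close>; this is why one notion serves both kinds of separability.
  The rigidity argument is the uniqueness half of Hensel's lemma, valid in every valued field: two
  roots with equal residues coincide if the derivative at one of them has nonzero residue. It
  compares residues of elements of the whole field, so the extended place has to agree with
  \<open>P\<close> on all of it and not just on \<open>K(T)\<close>; hence the extension starts from
  \<open>P\<close> itself and is restricted to the separable closure only at the end.\<close>

context
  fixes R :: "'a::field set"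
  assumes R: "is_subring R"
begin

lemma subring_one: "1 \<in> R"
  and subring_diff: "x \<in> R \<Longrightarrow> y \<in> R \<Longrightarrow> x - y \<in> R"
  and subring_mult: "x \<in> R \<Longrightarrow> y \<in> R \<Longrightarrow> x * y \<in> R"
  using R by (auto simp: is_subring_def)

lemma subring_zero: "0 \<in> R"
  using subring_diff[OF subring_one subring_one] by simp

lemma subring_uminus: "x \<in> R \<Longrightarrow> - x \<in> R"
  using subring_diff[OF subring_zero] by simp

lemma subring_add: "x \<in> R \<Longrightarrow> y \<in> R \<Longrightarrow> x + y \<in> R"
  using subring_diff[OF _ subring_uminus, of x y] by simp

lemma subring_power: "x \<in> R \<Longrightarrow> x ^ n \<in> R"
  by (induction n) (auto intro: subring_one subring_mult)

lemma subring_sum: "(\<And>i. i \<in> I \<Longrightarrow> f i \<in> R) \<Longrightarrow> sum f I \<in> R"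
  by (induction I rule: infinite_finite_induct) (auto intro: subring_zero subring_add)

lemma subring_prod: "(\<And>i. i \<in> I \<Longrightarrow> f i \<in> R) \<Longrightarrow> prod f I \<in> R"
  by (induction I rule: infinite_finite_induct) (auto intro: subring_one subring_mult)

lemma subring_of_nat: "of_nat n \<in> R"
  by (induction n) (auto intro: subring_zero subring_one subring_add)

lemmas subring_closed =
  subring_zero subring_one subring_uminus subring_diff subring_add subring_mult
  subring_power subring_sum subring_prod subring_of_nat

end

lemma subfield_subring: "is_subfield K \<Longrightarrow> is_subring K"
  by (simp add: is_subfield_def)

lemma subfield_inverse: "is_subfield K \<Longrightarrow> x \<in> K \<Longrightarrow> inverse x \<in> K"
  by (simp add: is_subfield_def)

lemma subfield_divide: "is_subfield K \<Longrightarrow> x \<in> K \<Longrightarrow> y \<in> K \<Longrightarrow> x / y \<in> K"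
  by (simp add: divide_inverse subfield_inverse subring_mult[OF subfield_subring])

lemma is_subring_ring_adjoin: "is_subring (ring_adjoin R S)"
  unfolding ring_adjoin_def by (rule hull_in) (auto simp: is_subring_def)

lemma is_subfield_field_adjoin: "is_subfield (field_adjoin K S)"
  unfolding field_adjoin_def by (rule hull_in) (auto simp: is_subfield_def is_subring_def)

lemma ring_adjoin_incl: "R \<union> S \<subseteq> ring_adjoin R S"
  unfolding ring_adjoin_def by (rule hull_subset)

lemma field_adjoin_incl: "K \<union> S \<subseteq> field_adjoin K S"
  unfolding field_adjoin_def by (rule hull_subset)

lemma ring_adjoin_least: "is_subring A \<Longrightarrow> R \<subseteq> A \<Longrightarrow> S \<subseteq> A \<Longrightarrow> ring_adjoin R S \<subseteq> A"
  unfolding ring_adjoin_def by (rule hull_minimal) auto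

lemma field_adjoin_least: "is_subfield A \<Longrightarrow> K \<subseteq> A \<Longrightarrow> S \<subseteq> A \<Longrightarrow> field_adjoin K S \<subseteq> A"
  unfolding field_adjoin_def by (rule hull_minimal) auto

lemma field_adjoin_mono: "K \<subseteq> K' \<Longrightarrow> S \<subseteq> S' \<Longrightarrow> field_adjoin K S \<subseteq> field_adjoin K' S'"
  using field_adjoin_incl[of K' S']
  by (intro field_adjoin_least is_subfield_field_adjoin) auto

lemma field_adjoin_empty: "is_subfield K \<Longrightarrow> field_adjoin K {} = K"
  unfolding field_adjoin_def by (simp add: hull_same)

lemma field_adjoin_Un: "field_adjoin K (S \<union> T) = field_adjoin (field_adjoin K S) T"
proof
  show "field_adjoin K (S \<union> T) \<subseteq> field_adjoin (field_adjoin K S) T"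
    using field_adjoin_incl[of K S] field_adjoin_incl[of "field_adjoin K S" T]
    by (intro field_adjoin_least is_subfield_field_adjoin) auto
  show "field_adjoin (field_adjoin K S) T \<subseteq> field_adjoin K (S \<union> T)"
    using field_adjoin_incl[of K "S \<union> T"] field_adjoin_mono[of K K S "S \<union> T"]
    by (intro field_adjoin_least is_subfield_field_adjoin) auto
qed

text \<open>The fractions form a subfield, so the hull is contained in them. In this shape a
  relation with coefficients in the generated field can be cleared of denominators.\<close>

lemma field_adjoin_fraction:
  assumes "x \<in> field_adjoin K S"
  shows "\<exists>a\<in>ring_adjoin K S. \<exists>b\<in>ring_adjoin K S. b \<noteq> 0 \<and> x = a / b"
proof -
  define R where "R = ring_adjoin K S"
  define A where "A = {a / b |a b. a \<in> R \<and> b \<in> R \<and> b \<noteq> 0}"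
  have R: "is_subring R"
    unfolding R_def by (rule is_subring_ring_adjoin)
  note [intro] = subring_closed[OF R]
  have A_I: "a / b \<in> A" if "a \<in> R" "b \<in> R" "b \<noteq> 0" for a b
    using that by (auto simp: A_def)
  have RA: "R \<subseteq> A"
    using A_I[of _ 1] by (auto simp: subring_one[OF R])
  have "is_subfield A"
    unfolding is_subfield_def is_subring_def
  proof (intro conjI ballI)
    show "1 \<in> A" using RA by auto
    fix x assume "x \<in> A"
    then obtain a b where x: "x = a / b" "a \<in> R" "b \<in> R" "b \<noteq> 0"
      by (auto simp: A_def)
    show "inverse x \<in> A"
    proof (cases "a = 0")
      case True
      then show ?thesis using x RA by auto
    next
      case False
      then show ?thesis using x A_I[of b a] by simp
    qed
    fix y assume "y \<in> A"
    then obtain c d where y: "y = c / d" "c \<in> R" "d \<in> R" "d \<noteq> 0"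
      by (auto simp: A_def)
    have "x - y = (a * d - c * b) / (b * d)" "x * y = (a * c) / (b * d)"
      using x y by (auto simp: field_simps)
    with x y show "x - y \<in> A" "x * y \<in> A"
      by (metis A_I R subring_diff subring_mult mult_eq_0_iff)+
  qed
  moreover have "K \<union> S \<subseteq> A"
    using RA ring_adjoin_incl[of K S] by (auto simp: R_def)
  ultimately have "field_adjoin K S \<subseteq> A"
    by (intro field_adjoin_least) auto
  with assms have "x \<in> A" by auto
  then show ?thesis
    by (auto simp: A_def R_def)
qed

section \<open>Univariate polynomials over a subring\<close>

text \<open>Subrings are sets and not types here, so \<open>R[X]\<close> is a subset of the
  polynomial ring over the ambient field.\<close>

definition poly_over :: "'a::zero set \<Rightarrow> 'a poly set" where
  "poly_over R = {p. \<forall>i. poly.coeff p i \<in> R}"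

lemma poly_over_mono: "R \<subseteq> R' \<Longrightarrow> poly_over R \<subseteq> poly_over R'"
  by (auto simp: poly_over_def)

lemma poly_over_pCons: "pCons a p \<in> poly_over R \<longleftrightarrow> a \<in> R \<and> p \<in> poly_over R"
  by (auto simp: poly_over_def coeff_pCons split: nat.splits)

context
  fixes R :: "'a::field set"
  assumes R: "is_subring R"
begin

lemma poly_over_zero: "0 \<in> poly_over R"
  and poly_over_diff: "p \<in> poly_over R \<Longrightarrow> q \<in> poly_over R \<Longrightarrow> p - q \<in> poly_over R"
  and poly_over_add: "p \<in> poly_over R \<Longrightarrow> q \<in> poly_over R \<Longrightarrow> p + q \<in> poly_over R"
  and poly_over_smult: "c \<in> R \<Longrightarrow> p \<in> poly_over R \<Longrightarrow> Polynomial.smult c p \<in> poly_over R"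
  and poly_over_monom: "c \<in> R \<Longrightarrow> Polynomial.monom c n \<in> poly_over R"
  and poly_over_mult: "p \<in> poly_over R \<Longrightarrow> q \<in> poly_over R \<Longrightarrow> p * q \<in> poly_over R"
  by (auto simp: poly_over_def coeff_mult intro: subring_closed[OF R])

lemma poly_over_one: "1 \<in> poly_over R"
  using poly_over_monom[OF subring_one[OF R], of 0] by simp

lemma poly_over_pderiv: "p \<in> poly_over R \<Longrightarrow> pderiv p \<in> poly_over R"
  by (auto simp: poly_over_def coeff_pderiv intro!: subring_mult[OF R] subring_of_nat[OF R]
      simp del: of_nat_Suc)

lemma poly_over_sum: "(\<And>i. i \<in> I \<Longrightarrow> f i \<in> poly_over R) \<Longrightarrow> sum f I \<in> poly_over R"
  by (induction I rule: infinite_finite_induct) (auto intro: poly_over_zero poly_over_add)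

lemma poly_in_subring: "p \<in> poly_over R \<Longrightarrow> x \<in> R \<Longrightarrow> poly p x \<in> R"
  by (auto simp: poly_altdef poly_over_def intro!: subring_closed[OF R])

text \<open>Dividing by a monic polynomial only multiplies and subtracts coefficients, so quotient
  and remainder stay over \<open>R\<close>. The alternative \<open>r = 0\<close> covers
  \<open>g = 1\<close>, where no degree is smaller.\<close>

lemma poly_over_division:
  assumes g: "g \<in> poly_over R" "Polynomial.lead_coeff g = 1" "f \<in> poly_over R"
  shows "\<exists>q\<in>poly_over R. \<exists>r\<in>poly_over R.
           f = q * g + r \<and> (r = 0 \<or> Polynomial.degree r < Polynomial.degree g)"
proof -
  \<comment> \<open>The induction runs over a strict bound on the support instead of the degree, so
    that the zero polynomial is the base case.\<close>
  have "\<exists>q\<in>poly_over R. \<exists>r\<in>poly_over R.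
           f = q * g + r \<and> (r = 0 \<or> Polynomial.degree r < Polynomial.degree g)"
    if "f \<in> poly_over R" "\<forall>i\<ge>n. poly.coeff f i = 0" for f n
    using that
  proof (induction n arbitrary: f)
    case 0
    then have "f = 0" by (simp add: poly_eq_iff)
    then show ?case
      by (intro bexI[of _ 0]) (auto intro: poly_over_zero)
  next
    case (Suc n)
    show ?case
    proof (cases "n < Polynomial.degree g")
      case True
      have "Polynomial.degree f \<le> n"
        using Suc.prems by (intro degree_le) auto
      with True have "f = 0 * g + f \<and> (f = 0 \<or> Polynomial.degree f < Polynomial.degree g)"
        by simp
      with Suc.prems(1) show ?thesis
        using poly_over_zero by blast
    next
      case False
      define m where "m = Polynomial.monom (poly.coeff f n) (n - Polynomial.degree g)"
      have m: "m \<in> poly_over R"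
        using Suc.prems unfolding m_def by (intro poly_over_monom) (auto simp: poly_over_def)
      have "\<exists>q\<in>poly_over R. \<exists>r\<in>poly_over R.
           f - m * g = q * g + r \<and> (r = 0 \<or> Polynomial.degree r < Polynomial.degree g)"
      proof (rule Suc.IH)
        show "f - m * g \<in> poly_over R"
          using m g Suc.prems by (intro poly_over_diff poly_over_mult)
        show "\<forall>i\<ge>n. poly.coeff (f - m * g) i = 0"
        proof (intro allI impI)
          fix i assume i: "i \<ge> n"
          show "poly.coeff (f - m * g) i = 0"
          proof (cases "i = n")
            case True
            then show ?thesis
              using False g(2) by (simp add: m_def coeff_monom_mult)
          next
            case neq: False
            then have "poly.coeff g (i - (n - Polynomial.degree g)) = 0"
              using i False by (intro coeff_eq_0) auto
            then show ?thesis
              using neq i Suc.prems False by (simp add: m_def coeff_monom_mult)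
          qed
        qed
      qed
      then obtain q r where qr: "q \<in> poly_over R" "r \<in> poly_over R" "f - m * g = q * g + r"
        "r = 0 \<or> Polynomial.degree r < Polynomial.degree g" by blast
      show ?thesis
      proof (intro bexI conjI)
        show "f = (q + m) * g + r" using qr(3) by (simp add: algebra_simps)
      qed (use qr m in \<open>auto intro: poly_over_add\<close>)
    qed
  qed
  from this[OF g(3), of "Suc (Polynomial.degree f)"] show ?thesis
    using coeff_eq_0 by (metis Suc_le_lessD)
qed

end

lemma ring_adjoin_singleton:
  assumes R: "is_subring R"
  shows "ring_adjoin R {x} = {poly p x |p. p \<in> poly_over R}"
proof
  show "ring_adjoin R {x} \<subseteq> {poly p x |p. p \<in> poly_over R}"
  proof (rule ring_adjoin_least)
    show "is_subring {poly p x |p. p \<in> poly_over R}"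
      unfolding is_subring_def
    proof (intro conjI ballI)
      show "1 \<in> {poly p x |p. p \<in> poly_over R}"
        using poly_over_one[OF R] by (force intro!: exI[of _ 1])
      fix a b assume "a \<in> {poly p x |p. p \<in> poly_over R}" "b \<in> {poly p x |p. p \<in> poly_over R}"
      then obtain p q where "p \<in> poly_over R" "q \<in> poly_over R" "a = poly p x" "b = poly q x"
        by auto
      then show "a - b \<in> {poly p x |p. p \<in> poly_over R}" "a * b \<in> {poly p x |p. p \<in> poly_over R}"
        using poly_over_diff[OF R, of p q] poly_over_mult[OF R, of p q]
        by (simp_all, metis poly_diff, metis poly_mult)
    qed
    show "R \<subseteq> {poly p x |p. p \<in> poly_over R}"
      using subring_zero[OF R]
      by (auto simp: poly_over_pCons poly_over_zero[OF R] intro!: exI[of _ "[:_:]"])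
    show "{x} \<subseteq> {poly p x |p. p \<in> poly_over R}"
      using poly_over_monom[OF R subring_one[OF R], of 1]
      by (auto simp: poly_monom intro!: exI[of _ "Polynomial.monom 1 1"])
  qed
  show "{poly p x |p. p \<in> poly_over R} \<subseteq> ring_adjoin R {x}"
    using ring_adjoin_incl[of R "{x}"] poly_over_mono[of R "ring_adjoin R {x}"]
    by (auto intro!: poly_in_subring is_subring_ring_adjoin)
qed

section \<open>Separable elements\<close>

lemma algebraic_over_subfield_iff:
  "algebraic_over_subfield K x \<longleftrightarrow> (\<exists>p\<in>poly_over K. p \<noteq> 0 \<and> poly p x = 0)"
  by (auto simp: algebraic_over_subfield_def poly_over_def)

lemma is_min_poly_iff:
  "is_min_poly K x p \<longleftrightarrow> Polynomial.lead_coeff p = 1 \<and> p \<in> poly_over K \<and> poly p x = 0 \<and>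
     (\<forall>q\<in>poly_over K. q \<noteq> 0 \<and> poly q x = 0 \<longrightarrow> Polynomial.degree p \<le> Polynomial.degree q)"
  by (auto simp: is_min_poly_def poly_over_def)

lemma min_poly_exists:
  assumes K: "is_subfield K" and "algebraic_over_subfield K x"
  shows "\<exists>p. is_min_poly K x p"
proof -
  note R = subfield_subring[OF K]
  define Q where "Q p \<longleftrightarrow> p \<in> poly_over K \<and> p \<noteq> 0 \<and> poly p x = 0" for p
  obtain p0 where "Q p0"
    using assms(2) by (auto simp: algebraic_over_subfield_iff Q_def)
  then obtain p where p: "Q p" and least: "\<And>q. Q q \<Longrightarrow> Polynomial.degree p \<le> Polynomial.degree q"
    using exists_least_iff[of "\<lambda>n. \<exists>p. Q p \<and> Polynomial.degree p = n"]
    by (metis linorder_not_less)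
  define c where "c = inverse (Polynomial.lead_coeff p)"
  have c: "c \<noteq> 0" "c \<in> K"
    using p by (auto simp: c_def Q_def poly_over_def intro: subfield_inverse[OF K])
  show ?thesis
    unfolding is_min_poly_iff
  proof (intro exI conjI ballI impI)
    show "Polynomial.lead_coeff (Polynomial.smult c p) = 1"
      using p by (simp add: c_def Q_def)
    show "Polynomial.smult c p \<in> poly_over K"
      using p c by (auto simp: Q_def intro: poly_over_smult[OF R])
    show "poly (Polynomial.smult c p) x = 0"
      using p by (simp add: Q_def)
    show "Polynomial.degree (Polynomial.smult c p) \<le> Polynomial.degree q"
      if "q \<in> poly_over K" "q \<noteq> 0 \<and> poly q x = 0" for q
      using least[of q] that c by (simp add: Q_def)
  qed
qed

lemma min_poly_dvd:
  assumes K: "is_subfield K" and f: "is_min_poly K x f" and g: "g \<in> poly_over K" "poly g x = 0"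
  shows "\<exists>q\<in>poly_over K. g = q * f"
proof -
  obtain q r where qr: "q \<in> poly_over K" "r \<in> poly_over K" "g = q * f + r"
    "r = 0 \<or> Polynomial.degree r < Polynomial.degree f"
    using poly_over_division[OF subfield_subring[OF K], of f g] f g
    by (auto simp: is_min_poly_iff)
  have "poly r x = 0"
    using qr(3) f g by (simp add: is_min_poly_iff)
  then have "r = 0"
    using qr f by (auto simp: is_min_poly_iff)
  with qr show ?thesis by auto
qed

lemma min_poly_degree_pos:
  assumes "is_min_poly K x f"
  shows "Polynomial.degree f > 0"
proof (rule ccontr)
  assume "\<not> Polynomial.degree f > 0"
  then obtain c where "f = [:c:]" by (auto elim: degree_eq_zeroE)
  then show False using assms by (auto simp: is_min_poly_def)
qed

text \<open>A minimal polynomial is irreducible, hence minimal for each of its roots.\<close>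

lemma min_poly_root_degree:
  assumes K: "is_subfield K" and f: "is_min_poly K x f" and y: "poly f y = 0"
    and q: "q \<in> poly_over K" "q \<noteq> 0" "poly q y = 0"
  shows "Polynomial.degree f \<le> Polynomial.degree q"
proof -
  have "algebraic_over_subfield K y"
    using q by (auto simp: algebraic_over_subfield_iff)
  then obtain g where g: "is_min_poly K y g"
    using min_poly_exists[OF K] by auto
  obtain h where h: "h \<in> poly_over K" "f = h * g"
    using min_poly_dvd[OF K g _ y] f by (auto simp: is_min_poly_iff)
  have f0: "f \<noteq> 0" using f by (auto simp: is_min_poly_iff)
  then have deg: "Polynomial.degree f = Polynomial.degree h + Polynomial.degree g"
    using h by (auto simp: degree_mult_eq)
  have "poly h x * poly g x = 0"
    using f h by (simp add: is_min_poly_iff)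
  then have "poly g x = 0"
    using f h deg f0 min_poly_degree_pos[OF g] by (force simp: is_min_poly_iff)
  then have "Polynomial.degree f \<le> Polynomial.degree g"
    using f g h f0 by (auto simp: is_min_poly_iff)
  also have "\<dots> \<le> Polynomial.degree q"
    using g q by (auto simp: is_min_poly_iff)
  finally show ?thesis .
qed

text \<open>After splitting off one factor \<open>X - a\<close>, the derivative at \<open>a\<close>
  equals the value of the cofactor at \<open>a\<close>.\<close>

lemma simple_root_iff_order:
  fixes p :: "'a::field poly"
  assumes "p \<noteq> 0" "poly p a = 0"
  shows "Polynomial.order a p = 1 \<longleftrightarrow> poly (pderiv p) a \<noteq> 0"
proof -
  obtain q where q: "p = [:-a, 1:] * q"
    using assms by (metis dvd_def poly_eq_0_iff_dvd)
  with assms have q0: "q \<noteq> 0" by auto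
  have "Polynomial.order a p = 1 + Polynomial.order a q"
    using q assms by (metis order_mult order_power_n_n power_one_right)
  moreover have "poly (pderiv p) a = poly q a"
    by (simp only: q pderiv_mult) (simp add: pderiv_pCons)
  ultimately show ?thesis
    using q0 by (auto simp: order_root)
qed

text \<open>A multiple root of \<open>f\<close> would be a root of the nonzero polynomial
  \<open>pderiv f\<close>, whose degree is smaller, although \<open>f\<close> is minimal for each of
  its roots.\<close>

lemma min_poly_rsquarefree:
  fixes x :: "'a::alg_closed_field"
  assumes K: "is_subfield K" and f: "is_min_poly K x f" and "pderiv f \<noteq> 0"
  shows "rsquarefree f"
  unfolding rsquarefree_def
proof (intro conjI allI)
  show f0: "f \<noteq> 0" using assms(3) by auto
  fix a
  show "Polynomial.order a f = 0 \<or> Polynomial.order a f = 1"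
  proof (cases "poly f a = 0")
    case True
    have "poly (pderiv f) a \<noteq> 0"
    proof
      assume "poly (pderiv f) a = 0"
      then have "Polynomial.degree f \<le> Polynomial.degree (pderiv f)"
        using f assms(3) True
        by (intro min_poly_root_degree[OF K f]) (auto simp: is_min_poly_iff
            intro: poly_over_pderiv[OF subfield_subring[OF K]])
      also have "\<dots> < Polynomial.degree f"
        using min_poly_degree_pos[OF f]
          degree_le[of "Polynomial.degree f - 1" "pderiv f"] by (simp add: coeff_pderiv coeff_eq_0)
      finally show False by simp
    qed
    then show ?thesis
      using simple_root_iff_order[OF f0 True] by auto
  qed (simp add: order_root)
qed

text \<open>Any simple root relation suffices: if the minimal polynomial \<open>f\<close> had
  derivative 0, every multiple \<open>q * f\<close> would have derivative 0 at
  \<open>x\<close>.\<close>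

lemma separable_over_subfieldI:
  fixes x :: "'a::alg_closed_field"
  assumes K: "is_subfield K" and p: "p \<in> poly_over K" "poly p x = 0" "poly (pderiv p) x \<noteq> 0"
  shows "separable_over_subfield K x"
proof -
  have "p \<noteq> 0" using p by auto
  then have "algebraic_over_subfield K x"
    using p by (auto simp: algebraic_over_subfield_iff)
  then obtain f where f: "is_min_poly K x f"
    using min_poly_exists[OF K] by auto
  obtain q where "p = q * f"
    using min_poly_dvd[OF K f p(1,2)] by auto
  then have "pderiv f \<noteq> 0"
    using p f by (auto simp: pderiv_mult is_min_poly_iff)
  then show ?thesis
    using min_poly_rsquarefree[OF K f] f by (auto simp: separable_over_subfield_def)
qed

lemma separable_over_subfieldE:
  fixes x :: "'a::alg_closed_field"
  assumes "separable_over_subfield K x"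
  obtains p where "p \<in> poly_over K" "poly p x = 0" "poly (pderiv p) x \<noteq> 0"
proof -
  obtain p where p: "is_min_poly K x p" "rsquarefree p"
    using assms by (auto simp: separable_over_subfield_def)
  have "p \<noteq> 0" "poly p x = 0"
    using p by (auto simp: rsquarefree_def is_min_poly_iff)
  moreover have "Polynomial.order x p = 1"
    using p calculation rsquarefree_root_order by blast
  ultimately show ?thesis
    using that[of p] p simple_root_iff_order[of p x] by (auto simp: is_min_poly_iff)
qed

lemma separable_over_subfield_mono:
  fixes x :: "'a::alg_closed_field"
  assumes "separable_over_subfield K x" "K \<subseteq> K'" "is_subfield K'"
  shows "separable_over_subfield K' x"
  using assms(1)
proof (rule separable_over_subfieldE)
  fix p assume "p \<in> poly_over K" "poly p x = 0" "poly (pderiv p) x \<noteq> 0"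
  then show ?thesis
    using assms poly_over_mono by (intro separable_over_subfieldI[of K' p]) auto
qed

text \<open>The multiset of linear factors is the multiset of roots, and squarefreeness makes every
  multiplicity 1. This count is what separability contributes to the disjointness argument.\<close>

lemma card_roots_rsquarefree:
  fixes f :: "'a::alg_closed_field poly"
  assumes "rsquarefree f"
  shows "card {x. poly f x = 0} = Polynomial.degree f"
proof -
  have f0: "f \<noteq> 0" using assms by (auto simp: rsquarefree_def)
  obtain A where A: "size A = Polynomial.degree f"
    "f = Polynomial.smult (Polynomial.lead_coeff f) (\<Prod>x\<in>#A. [:-x, 1:])"
    using alg_closed_imp_factorization[OF f0] by auto
  have "Polynomial.lead_coeff f \<noteq> 0" using f0 by simp
  then have "proots f = proots (\<Prod>x\<in>#A. [:-x, 1:])"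
    by (subst A(2)) (rule proots_smult)
  also have "\<dots> = A"
    by (induction A) (auto simp: proots_mult prod_mset_zero_iff image_iff simp del: mult_pCons_left)
  finally have "proots f = A" .
  then have c: "count A a = Polynomial.order a f" for a
    by (metis count_proots f0)
  have "set_mset A = {x. poly f x = 0}"
    using c f0 by (auto simp: order_root simp flip: count_greater_zero_iff)
  moreover have "count A a = 1" if "a \<in># A" for a
  proof -
    have "Polynomial.order a f = 0 \<or> Polynomial.order a f = 1"
      using assms by (auto simp: rsquarefree_def)
    then show ?thesis using c[of a] that by (auto simp flip: count_greater_zero_iff)
  qed
  ultimately show ?thesis
    using A(1) by (simp add: size_multiset_overloaded_eq)
qed

section \<open>Linear disjointness from purely inseparable extensions\<close>

text \<open>In characteristic zero the exponent is 1 and the identity is trivial; the characteristic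
  exponent thus keeps all later arguments uniform in the characteristic.\<close>

lemma frobenius_sum:
  fixes f :: "'i \<Rightarrow> 'a::idom"
  shows "sum f A ^ (max 1 CHAR('a) ^ n) = (\<Sum>i\<in>A. f i ^ (max 1 CHAR('a) ^ n))"
proof (cases "CHAR('a) = 0")
  case False
  then have "max 1 CHAR('a) = CHAR('a)" by simp
  then show ?thesis
    using False by (simp add: freshmans_dream_sum'[OF prime_CHAR_semidom refl])
qed simp

text \<open>Only the \<open>q\<close>-th powers of the coefficients are assumed to lie in
  \<open>R\<close>. The polynomial ring has the same characteristic as the field, so the power of a
  sum of monomials is the sum of their powers.\<close>

lemma frobenius_power_poly_over:
  fixes h :: "'a::field poly"
  assumes R: "is_subring R" and h: "\<And>i. poly.coeff h i ^ (max 1 CHAR('a) ^ n) \<in> R"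
  shows "h ^ (max 1 CHAR('a) ^ n) \<in> poly_over R"
proof -
  have "h ^ (max 1 CHAR('a) ^ n) =
      (\<Sum>i\<le>Polynomial.degree h. Polynomial.monom (poly.coeff h i) i) ^ (max 1 CHAR('a poly) ^ n)"
    by (simp add: poly_as_sum_of_monoms)
  also have "\<dots> = (\<Sum>i\<le>Polynomial.degree h. Polynomial.monom (poly.coeff h i) i ^ (max 1 CHAR('a poly) ^ n))"
    by (rule frobenius_sum)
  also have "\<dots> \<in> poly_over R"
    using h by (auto simp: monom_power intro!: poly_over_sum[OF R] poly_over_monom[OF R])
  finally show ?thesis .
qed

lemma lin_indep_overD:
  assumes "lin_indep_over K S" "\<And>x. x \<in> S \<Longrightarrow> c x \<in> K" "(\<Sum>x\<in>S. c x * x) = 0" "x \<in> S"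
  shows "c x = 0"
  using assms unfolding lin_indep_over_def by blast

lemma lin_indep_over_fractions:
  assumes R: "is_subring R" and fin: "finite S" and indep: "lin_indep_over R S"
    and F: "\<And>y. y \<in> F \<Longrightarrow> \<exists>a\<in>R. \<exists>b\<in>R. b \<noteq> 0 \<and> y = a / b"
  shows "lin_indep_over F S"
  unfolding lin_indep_over_def
proof (intro allI impI, elim conjE)
  fix c assume c: "\<forall>x\<in>S. c x \<in> F" and sum0: "(\<Sum>x\<in>S. c x * x) = 0"
  have "\<forall>x\<in>S. \<exists>b. b \<in> R \<and> b \<noteq> 0 \<and> c x * b \<in> R"
    using F c by fastforce
  then obtain b where b: "\<And>x. x \<in> S \<Longrightarrow> b x \<in> R \<and> b x \<noteq> 0 \<and> c x * b x \<in> R"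
    by metis
  \<comment> \<open>A common denominator, by which the whole relation is multiplied into
    \<open>R\<close>.\<close>
  define d where "d = prod b S"
  have d0: "d \<noteq> 0" using b fin by (auto simp: d_def)
  have "c x * d \<in> R" if "x \<in> S" for x
  proof -
    have "c x * d = (c x * b x) * prod b (S - {x})"
      using fin that by (simp add: d_def prod.remove[of S x])
    moreover have "prod b (S - {x}) \<in> R"
      using b by (intro subring_prod[OF R]) auto
    ultimately show ?thesis
      using b[OF that] subring_mult[OF R] by metis
  qed
  moreover have "(\<Sum>x\<in>S. (c x * d) * x) = d * (\<Sum>x\<in>S. c x * x)"
    by (simp add: sum_distrib_left mult_ac)
  ultimately have "c x * d = 0" if "x \<in> S" for x
    using lin_indep_overD[OF indep, of "\<lambda>x. c x * d" x] sum0 that by simp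
  with d0 show "\<forall>x\<in>S. c x = 0" by simp
qed

text \<open>Linear disjointness of \<open>F\<close> from the perfect closure of \<open>L\<close> over \<open>L\<close>; finitely many
  elements of the perfect closure lie in a common \<open>L\<^bsup>1/q\<^esup>\<close>, with \<open>q\<close> a power of the
  characteristic exponent.\<close>

definition frobenius_disjoint :: "'a::field set \<Rightarrow> 'a set \<Rightarrow> bool" where
  "frobenius_disjoint L F \<longleftrightarrow>
     (\<forall>S n. finite S \<and> (\<forall>s\<in>S. s ^ (max 1 CHAR('a) ^ n) \<in> L) \<and> lin_indep_over L S \<longrightarrow>
            lin_indep_over F S)"

lemma frobenius_disjoint_refl: "frobenius_disjoint L L"
  by (auto simp: frobenius_disjoint_def)

lemma frobenius_disjoint_trans:
  assumes "frobenius_disjoint K L" "frobenius_disjoint L F" "K \<subseteq> L"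
  shows "frobenius_disjoint K F"
  using assms unfolding frobenius_disjoint_def by (meson subsetD)

text \<open>In a relation over \<open>L[x]\<close> the coefficients are written as polynomials in
  \<open>x\<close> of degree below that of the minimal polynomial \<open>f\<close>. Collecting the
  powers of \<open>x\<close> gives a polynomial \<open>h\<close> that vanishes at \<open>x\<close>.
  Its power \<open>h ^ q\<close> lies over \<open>L\<close> and is therefore divisible by
  \<open>f\<close>, so \<open>h\<close> vanishes at all the distinct roots of \<open>f\<close>.
  These are too many unless \<open>h = 0\<close>, and then each coefficient of \<open>h\<close> is a
  relation over \<open>L\<close> between the elements of \<open>S\<close>.\<close>

lemma frobenius_disjoint_separable:
  fixes x :: "'a::alg_closed_field"
  assumes L: "is_subfield L" and x: "separable_over_subfield L x"
  shows "frobenius_disjoint L (field_adjoin L {x})"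
  unfolding frobenius_disjoint_def
proof (intro allI impI, elim conjE)
  fix S :: "'a set" and n
  define q where "q = max 1 CHAR('a) ^ n"
  assume fin: "finite S" and S: "\<forall>s\<in>S. s ^ (max 1 CHAR('a) ^ n) \<in> L" and indep: "lin_indep_over L S"
  note R = subfield_subring[OF L]
  note adj = ring_adjoin_singleton[OF R, of x]
  obtain f where f: "is_min_poly L x f" "rsquarefree f"
    using x by (auto simp: separable_over_subfield_def)
  have "lin_indep_over (ring_adjoin L {x}) S"
    unfolding lin_indep_over_def
  proof (intro allI impI, elim conjE)
    fix c assume c: "\<forall>s\<in>S. c s \<in> ring_adjoin L {x}" and sum0: "(\<Sum>s\<in>S. c s * s) = 0"
    have "\<exists>p. p \<in> poly_over L \<and> poly p x = c s \<and> Polynomial.degree p < Polynomial.degree f"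
      if "s \<in> S" for s
    proof -
      obtain p where p: "p \<in> poly_over L" "c s = poly p x"
        using c \<open>s \<in> S\<close> unfolding adj by auto
      obtain q r where qr: "q \<in> poly_over L" "r \<in> poly_over L" "p = q * f + r"
        "r = 0 \<or> Polynomial.degree r < Polynomial.degree f"
        using poly_over_division[OF R _ _ p(1), of f] f by (auto simp: is_min_poly_iff)
      have "poly r x = c s"
        using qr(3) p f by (simp add: is_min_poly_iff)
      then show ?thesis
        using qr min_poly_degree_pos[OF f(1)] by auto
    qed
    then obtain p where p: "\<And>s. s \<in> S \<Longrightarrow> p s \<in> poly_over L" "\<And>s. s \<in> S \<Longrightarrow> poly (p s) x = c s"
      "\<And>s. s \<in> S \<Longrightarrow> Polynomial.degree (p s) < Polynomial.degree f"
      by metis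
    define h where "h = (\<Sum>s\<in>S. Polynomial.smult s (p s))"
    have coeff_h: "poly.coeff h k = (\<Sum>s\<in>S. poly.coeff (p s) k * s)" for k
      by (simp add: h_def coeff_sum mult.commute)
    have hx: "poly h x = 0"
      using sum0 p by (simp add: h_def poly_sum mult.commute)
    have deg: "Polynomial.degree h < Polynomial.degree f"
      unfolding h_def using p min_poly_degree_pos[OF f(1)]
      by (intro degree_sum_less) (auto intro: le_less_trans[OF degree_smult_le])
    \<comment> \<open>The coefficients of \<open>h\<close> are sums of elements of \<open>L\<close>
      times elements of \<open>S\<close>, so their \<open>q\<close>-th powers lie in
      \<open>L\<close>.\<close>
    have "h ^ q \<in> poly_over L"
      unfolding q_def
    proof (rule frobenius_power_poly_over[OF R])
      fix i
      show "poly.coeff h i ^ (max 1 CHAR('a) ^ n) \<in> L"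
        unfolding coeff_h frobenius_sum power_mult_distrib
        using p(1) S
        by (intro subring_sum[OF R] subring_mult[OF R]) (auto simp: poly_over_def intro: subring_power[OF R])
    qed
    moreover have "poly (h ^ q) x = 0"
      using hx by (simp add: q_def less_max_iff_disj)
    ultimately obtain g where g: "h ^ q = g * f"
      using min_poly_dvd[OF L f(1)] by blast
    have "poly h y = 0" if "poly f y = 0" for y
    proof -
      have "poly h y ^ q = 0"
        using arg_cong[OF g, of "\<lambda>p. poly p y"] that by simp
      then show ?thesis by simp
    qed
    then have sub: "{y. poly f y = 0} \<subseteq> {y. poly h y = 0}" by auto
    have h0: "h = 0"
    proof (rule ccontr)
      assume "h \<noteq> 0"
      then have "Polynomial.degree f \<le> Polynomial.degree h"
        using card_mono[OF poly_roots_finite sub] card_poly_roots_bound[of h]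
          card_roots_rsquarefree[OF f(2)] by fastforce
      with deg show False by simp
    qed
    show "\<forall>s\<in>S. c s = 0"
    proof
      fix s assume s: "s \<in> S"
      have "poly.coeff (p s) k = 0" for k
      proof (rule lin_indep_overD[OF indep _ _ s, of "\<lambda>s. poly.coeff (p s) k"])
        show "(\<Sum>s\<in>S. poly.coeff (p s) k * s) = 0"
          using coeff_h[of k] h0 by simp
      qed (use p(1) in \<open>auto simp: poly_over_def\<close>)
      then have "p s = 0" by (simp add: poly_eq_iff)
      then show "c s = 0" using p(2)[OF s] by simp
    qed
  qed
  then show "lin_indep_over (field_adjoin L {x}) S"
    by (rule lin_indep_over_fractions[OF is_subring_ring_adjoin fin]) (rule field_adjoin_fraction)
qed

text \<open>Greedy choice: an element is added exactly if it is not yet in the span. A relation in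
  the enlarged set with nonzero coefficient at \<open>x\<close> could be solved for
  \<open>x\<close>.\<close>

lemma lin_indep_spanning_subset:
  assumes L: "is_subfield L" and "finite C"
  shows "\<exists>B\<subseteq>C. lin_indep_over L B \<and> (\<forall>c\<in>C. \<exists>\<alpha>. (\<forall>b\<in>B. \<alpha> b \<in> L) \<and> c = (\<Sum>b\<in>B. \<alpha> b * b))"
  using assms(2)
proof (induction C rule: finite_induct)
  case empty
  then show ?case by (auto simp: lin_indep_over_def)
next
  case (insert x C)
  note R = subfield_subring[OF L]
  obtain B where B: "B \<subseteq> C" "lin_indep_over L B"
    "\<And>c. c \<in> C \<Longrightarrow> \<exists>\<alpha>. (\<forall>b\<in>B. \<alpha> b \<in> L) \<and> c = (\<Sum>b\<in>B. \<alpha> b * b)"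
    using insert.IH by blast
  have finB: "finite B" and xB: "x \<notin> B"
    using B insert.hyps finite_subset by auto
  show ?case
  proof (cases "\<exists>\<alpha>. (\<forall>b\<in>B. \<alpha> b \<in> L) \<and> x = (\<Sum>b\<in>B. \<alpha> b * b)")
    case True
    then show ?thesis
      using B by (intro exI[of _ B]) auto
  next
    case False
    have "lin_indep_over L (insert x B)"
      unfolding lin_indep_over_def
    proof (intro allI impI, elim conjE)
      fix c assume c: "\<forall>b\<in>insert x B. c b \<in> L" and "(\<Sum>b\<in>insert x B. c b * b) = 0"
      then have sum0: "c x * x + (\<Sum>b\<in>B. c b * b) = 0"
        using finB xB by simp
      have "c x = 0"
      proof (rule ccontr)
        assume cx: "c x \<noteq> 0"
        have "x = - (\<Sum>b\<in>B. c b * b) / c x"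
          using sum0 cx by (simp add: field_simps add_eq_0_iff)
        also have "\<dots> = (\<Sum>b\<in>B. (- c b / c x) * b)"
          by (simp add: sum_divide_distrib sum_negf)
        finally have "x = (\<Sum>b\<in>B. (- c b / c x) * b)" .
        moreover have "\<forall>b\<in>B. - c b / c x \<in> L"
          using c by (auto intro!: subfield_divide[OF L] subring_uminus[OF R])
        ultimately show False
          using False[unfolded not_ex, rule_format, of "\<lambda>b. - c b / c x"] by simp
      qed
      with sum0 B(2) c show "\<forall>b\<in>insert x B. c b = 0"
        by (auto simp: lin_indep_over_def)
    qed
    moreover have "\<exists>\<alpha>. (\<forall>b\<in>insert x B. \<alpha> b \<in> L) \<and> c = (\<Sum>b\<in>insert x B. \<alpha> b * b)"
      if c: "c \<in> insert x C" for c
    proof (cases "c = x")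
      case True
      have "(\<Sum>b\<in>B. (if b = x then 1 else 0) * b) = 0"
        using xB by (intro sum.neutral) auto
      then show ?thesis
        using True finB xB subring_zero[OF R] subring_one[OF R]
        by (intro exI[of _ "\<lambda>b. if b = x then 1 else 0"]) auto
    next
      case False
      then obtain \<alpha> where \<alpha>: "\<forall>b\<in>B. \<alpha> b \<in> L" "c = (\<Sum>b\<in>B. \<alpha> b * b)"
        using B(3) c by blast
      have "(\<Sum>b\<in>B. (\<alpha>(x := 0)) b * b) = (\<Sum>b\<in>B. \<alpha> b * b)"
        using xB by (intro sum.cong) auto
      then show ?thesis
        using \<alpha> finB xB subring_zero[OF R] by (intro exI[of _ "\<alpha>(x := 0)"]) auto
    qed
    ultimately show ?thesis
      using B(1) by (intro exI[of _ "insert x B"]) auto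
  qed
qed

text \<open>The symmetric form of linear disjointness: expand the coefficients in a basis of their
  \<open>L\<close>-span and compare the coefficients of the basis elements.\<close>

lemma frobenius_disjoint_family:
  fixes x :: "'i \<Rightarrow> 'a::field"
  assumes L: "is_subfield L" and F: "is_subring F" "L \<subseteq> F" and disj: "frobenius_disjoint L F"
    and fin: "finite I" and x: "\<And>i. i \<in> I \<Longrightarrow> x i \<in> F"
    and indep: "\<And>c. (\<And>i. i \<in> I \<Longrightarrow> c i \<in> L) \<Longrightarrow> (\<Sum>i\<in>I. c i * x i) = 0 \<Longrightarrow> \<forall>i\<in>I. c i = 0"
    and c: "\<And>i. i \<in> I \<Longrightarrow> c i ^ (max 1 CHAR('a) ^ n) \<in> L"
    and sum0: "(\<Sum>i\<in>I. c i * x i) = 0"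
  shows "\<forall>i\<in>I. c i = 0"
proof -
  obtain B where B: "B \<subseteq> c ` I" "lin_indep_over L B"
    "\<forall>c\<in>c ` I. \<exists>\<alpha>. (\<forall>b\<in>B. \<alpha> b \<in> L) \<and> c = (\<Sum>b\<in>B. \<alpha> b * b)"
    using lin_indep_spanning_subset[OF L, of "c ` I"] fin by blast
  have finB: "finite B"
    using B fin finite_surj by blast
  have "\<forall>i\<in>I. \<exists>\<alpha>. (\<forall>b\<in>B. \<alpha> b \<in> L) \<and> c i = (\<Sum>b\<in>B. \<alpha> b * b)"
    using B(3) by simp
  then obtain \<alpha> where \<alpha>: "\<And>i b. i \<in> I \<Longrightarrow> b \<in> B \<Longrightarrow> \<alpha> i b \<in> L"
    "\<And>i. i \<in> I \<Longrightarrow> c i = (\<Sum>b\<in>B. \<alpha> i b * b)"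
    by metis
  \<comment> \<open>The elements of \<open>B\<close> are among the \<open>c i\<close>, so their
    \<open>q\<close>-th powers lie in \<open>L\<close> and the disjointness hypothesis applies to
    \<open>B\<close>.\<close>
  have li: "lin_indep_over F B"
  proof (rule disj[unfolded frobenius_disjoint_def, rule_format, of _ n], intro conjI)
    show "\<forall>s\<in>B. s ^ (max 1 CHAR('a) ^ n) \<in> L"
      using B(1) c by auto
  qed (use finB B(2) in auto)
  have "(\<Sum>b\<in>B. (\<Sum>i\<in>I. \<alpha> i b * x i) * b) = 0"
  proof -
    have "(\<Sum>b\<in>B. (\<Sum>i\<in>I. \<alpha> i b * x i) * b) = (\<Sum>i\<in>I. \<Sum>b\<in>B. \<alpha> i b * x i * b)"
      unfolding sum_distrib_right by (rule sum.swap)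
    also have "\<dots> = (\<Sum>i\<in>I. c i * x i)"
      using \<alpha> by (intro sum.cong) (auto simp: sum_distrib_left sum_distrib_right mult_ac)
    finally show ?thesis using sum0 by simp
  qed
  moreover have "\<forall>b\<in>B. (\<Sum>i\<in>I. \<alpha> i b * x i) \<in> F"
    using \<alpha> x F by (auto intro!: subring_sum[OF F(1)] subring_mult[OF F(1)])
  ultimately have "\<forall>b\<in>B. (\<Sum>i\<in>I. \<alpha> i b * x i) = 0"
    using lin_indep_overD[OF li, of "\<lambda>b. \<Sum>i\<in>I. \<alpha> i b * x i"] by blast
  then have "\<forall>b\<in>B. \<forall>i\<in>I. \<alpha> i b = 0"
    using indep[of "\<lambda>i. \<alpha> i _"] \<alpha> by blast
  then show ?thesis using \<alpha>(2) by simp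
qed

text \<open>If the minimal polynomial were a polynomial in \<open>X ^ p\<close>, its coefficients would have \<open>p\<close>-th
  roots, which give a relation between fewer powers of \<open>x\<close>.\<close>

lemma separable_if_frobenius_disjoint:
  fixes x :: "'a::alg_closed_field"
  assumes L: "is_subfield L" and F: "is_subring F" "L \<subseteq> F" and disj: "frobenius_disjoint L F"
    and x: "x \<in> F" "algebraic_over_subfield L x"
  shows "separable_over_subfield L x"
proof -
  obtain f where f: "is_min_poly L x f"
    using min_poly_exists[OF L x(2)] by auto
  define d where "d = Polynomial.degree f"
  have d: "d > 0" using min_poly_degree_pos[OF f] by (simp add: d_def)
  have "pderiv f \<noteq> 0"
  proof
    assume "pderiv f = 0"
    then have *: "of_nat (Suc i) * poly.coeff f (Suc i) = 0" for i
      by (metis coeff_0 coeff_pderiv)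
    define p where "p = CHAR('a)"
    have dvd: "p dvd i" if "poly.coeff f i \<noteq> 0" for i
      using *[of "i - 1"] that of_nat_eq_0_iff_char_dvd[of i, where ?'a = 'a]
      by (cases i) (auto simp: p_def simp del: of_nat_Suc)
    have lc: "poly.coeff f d = 1" using f by (simp add: d_def is_min_poly_def)
    then have pd: "p dvd d" using dvd by simp
    \<comment> \<open>In characteristic zero \<open>p\<close> is 0 and divides only 0, contrary to
      \<open>d > 0\<close>.\<close>
    have "p > 0" using pd d by (auto intro: Nat.gr0I)
    then have p1: "p > 1"
      using prime_CHAR_semidom[where ?'a = 'a] prime_gt_1_nat by (simp add: p_def)
    define m where "m = d div p"
    have dm: "d = p * m" and m: "m < d"
      using pd p1 d by (auto simp: m_def)
    have "\<exists>y. y ^ p = poly.coeff f (p * k)" for k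
      using nth_root_exists \<open>p > 0\<close> by blast
    then obtain c where c: "\<And>k. c k ^ p = poly.coeff f (p * k)" by metis
    have q: "max 1 CHAR('a) ^ 1 = p"
      using p1 by (simp add: p_def)
    \<comment> \<open>By the choice of the \<open>c k\<close>, this power is \<open>f(x)\<close>
      without the terms whose index is not divisible by \<open>p\<close>, and those terms
      vanish.\<close>
    have "(\<Sum>k\<in>{..m}. c k * x ^ k) ^ p = (\<Sum>k\<le>m. poly.coeff f (p * k) * x ^ (p * k))"
      using frobenius_sum[of "\<lambda>k. c k * x ^ k" "{..m}" 1] unfolding q
      by (simp add: power_mult_distrib c mult.commute[of p] power_mult)
    also have "\<dots> = (\<Sum>i\<in>(*) p ` {..m}. poly.coeff f i * x ^ i)"
      using \<open>p > 0\<close> by (subst sum.reindex) (auto simp: inj_on_def)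
    also have "\<dots> = (\<Sum>i\<le>d. poly.coeff f i * x ^ i)"
    proof (rule sum.mono_neutral_left)
      show "\<forall>i\<in>{..d} - (*) p ` {..m}. poly.coeff f i * x ^ i = 0"
      proof
        fix i assume i: "i \<in> {..d} - (*) p ` {..m}"
        have "\<not> p dvd i"
        proof
          assume "p dvd i"
          then obtain k where "i = p * k" by (rule dvdE)
          with i \<open>p > 0\<close> show False by (auto simp: dm)
        qed
        then show "poly.coeff f i * x ^ i = 0" using dvd[of i] by auto
      qed
    qed (use dm in auto)
    also have "\<dots> = 0"
      using f by (simp add: d_def is_min_poly_def poly_altdef)
    finally have rel: "(\<Sum>k\<in>{..m}. c k * x ^ k) = 0"
      using \<open>p > 0\<close> by simp
    have root: "c k ^ (max 1 CHAR('a) ^ 1) \<in> L" for k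
      unfolding q c using f by (simp add: is_min_poly_def)
    \<comment> \<open>A relation between the powers up to \<open>m\<close> is a polynomial of degree
      below \<open>d = p * m\<close> that vanishes at \<open>x\<close>.\<close>
    have indep: "\<forall>i\<in>{..m}. e i = 0" if e: "\<And>i. i \<in> {..m} \<Longrightarrow> e i \<in> L" "(\<Sum>i\<in>{..m}. e i * x ^ i) = 0" for e
    proof -
      define g where "g = (\<Sum>i\<le>m. Polynomial.monom (e i) i)"
      have g: "g \<in> poly_over L" "poly g x = 0"
        using e by (auto simp: g_def poly_sum poly_monom intro!: poly_over_sum poly_over_monom
            subfield_subring[OF L])
      have "Polynomial.degree g < d"
        unfolding g_def using d m
        by (intro degree_sum_less) (auto intro: le_less_trans[OF degree_monom_le])
      then have "g = 0"
        using f g by (auto simp: is_min_poly_iff d_def)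
      moreover have "poly.coeff g i = e i" if "i \<le> m" for i
        using that by (simp add: g_def coeff_sum coeff_monom)
      ultimately show ?thesis by auto
    qed
    have "\<forall>k\<in>{..m}. c k = 0"
    proof (rule frobenius_disjoint_family[where I = "{..m}" and x = "\<lambda>k. x ^ k" and c = c and n = 1,
          OF L F disj finite_atMost])
      show "x ^ k \<in> F" for k by (rule subring_power[OF F(1) x(1)])
      show "\<forall>i\<in>{..m}. e i = 0"
        if "\<And>i. i \<in> {..m} \<Longrightarrow> e i \<in> L" "(\<Sum>i\<in>{..m}. e i * x ^ i) = 0" for e
        by (rule indep[OF that])
    qed (rule root, rule rel)
    \<comment> \<open>Since \<open>p * m = d\<close>, the power \<open>c m ^ p\<close> is the
      leading coefficient 1.\<close>
    then show False
      using c[of m] lc dm \<open>p > 0\<close> by (simp add: power_0_left)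
  qed
  then show ?thesis
    using min_poly_rsquarefree[OF L f] f by (auto simp: separable_over_subfield_def)
qed

section \<open>Closure of the algebraic and of the separable elements under the field
  operations\<close>

lemma separable_imp_algebraic:
  "separable_over_subfield L x \<Longrightarrow> algebraic_over_subfield L x"
  by (auto simp: separable_over_subfield_def is_min_poly_iff algebraic_over_subfield_iff
      rsquarefree_def)

text \<open>The result is transferred from \<open>HOL-Algebra\<close> by viewing the type as a ring
  with carrier \<open>UNIV\<close>; the work lies in matching the two notions of polynomial and of
  algebraic element.\<close>

lemma is_subfield_algebraic:
  assumes K: "is_subfield (K :: 'a::field set)"
  shows "is_subfield {x. algebraic_over_subfield K x}"
proof -
  let ?R = "ring_of_type_algebra :: 'a ring"
  interpret R: field ?R by rule
  note KR = subfield_subring[OF K]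
  have simps [simp]: "carrier ?R = UNIV" "monoid.mult ?R = (*)" "one ?R = 1" "ring.zero ?R = 0" "add ?R = (+)"
    by (auto simp: ring_of_type_algebra_def)
  have pow [simp]: "x [^]\<^bsub>?R\<^esub> n = x ^ n" for x :: 'a and n :: nat
    by (induction n) (auto simp: mult.commute)
  have a_inv: "\<ominus>\<^bsub>?R\<^esub> x = - x" for x
    using R.minus_equality[of "-x" x] by simp
  have m_inv: "inv\<^bsub>?R\<^esub> x = inverse x" if "x \<noteq> 0" for x
    using that by (intro R.inv_char) auto
  have K': "subfield K ?R"
  proof (rule R.subfieldI')
    show "subring K ?R"
      by (rule R.subringI) (auto simp: a_inv intro: subring_closed[OF KR])
    show "inv\<^bsub>?R\<^esub> k \<in> K" if "k \<in> K - {\<zero>\<^bsub>?R\<^esub>}" for k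
      using that by (auto simp: m_inv intro: subfield_inverse[OF K])
  qed
  \<comment> \<open>List polynomials carry the leading coefficient at the head, whereas
    \<open>Poly\<close> expects the constant one there; hence the reversals.\<close>
  have eval: "R.eval p x = poly (Poly (rev p)) x" for p x
    by (induction p) (auto simp: Poly_append poly_monom)
  have alg: "(R.algebraic over K) x \<longleftrightarrow> algebraic_over_subfield K x" for x
  proof
    assume "(R.algebraic over K) x"
    then obtain p where p: "p \<in> carrier (K[X]\<^bsub>?R\<^esub>)" "p \<noteq> []" "R.eval p x = \<zero>\<^bsub>?R\<^esub>"
      using R.algebraicE[OF subfieldE(1)[OF K']] by auto
    then have "set p \<subseteq> K" "hd p \<noteq> 0"
      by (auto simp: univ_poly_def polynomial_def)
    have "Poly (rev p) \<in> poly_over K"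
      unfolding poly_over_def mem_Collect_eq coeff_Poly_eq
    proof
      fix i
      show "nth_default 0 (rev p) i \<in> K"
        using nth_mem[of i "rev p"] \<open>set p \<subseteq> K\<close> subring_zero[OF KR]
        by (cases "i < length p") (auto simp: nth_default_def)
    qed
    moreover have "Poly (rev p) \<noteq> 0"
    proof
      assume "Poly (rev p) = 0"
      then obtain n where "rev p = replicate n 0" by (auto simp: Poly_eq_0)
      then have "p = replicate n 0" by (simp add: rev_swap)
      then show False using \<open>hd p \<noteq> 0\<close> p(2) by simp
    qed
    ultimately
    show "algebraic_over_subfield K x"
      using p(3) eval by (auto simp: algebraic_over_subfield_iff)
  next
    assume "algebraic_over_subfield K x"
    then obtain p where p: "p \<in> poly_over K" "p \<noteq> 0" "poly p x = 0"
      by (auto simp: algebraic_over_subfield_iff)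
    show "(R.algebraic over K) x"
    proof (rule R.algebraicI)
      show "rev (coeffs p) \<in> carrier (K[X]\<^bsub>?R\<^esub>)"
        using p by (auto simp: univ_poly_def polynomial_def poly_over_def coeffs_def hd_rev last_map
            last_coeffs_eq_coeff_degree)
      show "rev (coeffs p) \<noteq> []" using p by simp
      show "R.eval (rev (coeffs p)) x = \<zero>\<^bsub>?R\<^esub>"
        using p by (simp add: eval)
    qed
  qed
  have "subfield {x \<in> carrier ?R. (R.algebraic over K) x} ?R"
    by (rule R.subfield_of_algebraics[OF K'])
  then have A: "subfield {x. algebraic_over_subfield K x} ?R"
    by (simp add: alg)
  note sub = subfieldE(1)[OF A]
  show ?thesis
    unfolding is_subfield_def is_subring_def
  proof (intro conjI ballI)
    show "1 \<in> {x. algebraic_over_subfield K x}"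
      using subringE(3)[OF sub] by simp
    fix x assume x: "x \<in> {x. algebraic_over_subfield K x}"
    show "inverse x \<in> {x. algebraic_over_subfield K x}"
    proof (cases "x = 0")
      case False
      then show ?thesis
        using R.subfield_m_inv(1)[OF A, of x] x m_inv[of x] by simp
    qed (use x in simp)
    fix y assume y: "y \<in> {x. algebraic_over_subfield K x}"
    show "x * y \<in> {x. algebraic_over_subfield K x}"
      using subringE(6)[OF sub x y] by simp
    show "x - y \<in> {x. algebraic_over_subfield K x}"
      using subringE(7)[OF sub x subringE(5)[OF sub y]] by (simp add: a_inv)
  qed
qed

text \<open>Differences, products and inverses lie in \<open>L(x)(y)\<close>, which is reached from
  \<open>L\<close> by two simple separable steps and so is disjoint from the \<open>q\<close>-th
  roots over \<open>L\<close>. By the converse criterion its elements algebraic over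
  \<open>L\<close> are separable.\<close>

lemma is_subfield_sep_closure:
  assumes L: "is_subfield L"
  shows "is_subfield (sep_closure L)"
proof -
  note alg = is_subfield_algebraic[OF L]
  have key: "z \<in> sep_closure L"
    if x: "x \<in> sep_closure L" and y: "y \<in> sep_closure L"
      and z: "z \<in> field_adjoin (field_adjoin L {x}) {y}" "algebraic_over_subfield L z" for x y z
  proof -
    let ?E = "field_adjoin L {x}"
    have LE: "L \<subseteq> ?E" using field_adjoin_incl[of L "{x}"] by auto
    have EF: "?E \<subseteq> field_adjoin ?E {y}" using field_adjoin_incl[of ?E "{y}"] by auto
    have "frobenius_disjoint L ?E" "frobenius_disjoint ?E (field_adjoin ?E {y})"
      using x y LE L unfolding sep_closure_def
      by (auto intro!: frobenius_disjoint_separable is_subfield_field_adjoin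
          intro: separable_over_subfield_mono)
    then have "frobenius_disjoint L (field_adjoin ?E {y})"
      using frobenius_disjoint_trans LE by blast
    then show ?thesis
      unfolding sep_closure_def
      using z LE EF by (auto intro!: separable_if_frobenius_disjoint[OF L, of "field_adjoin ?E {y}"]
          subfield_subring is_subfield_field_adjoin)
  qed
  have gen: "x \<in> field_adjoin (field_adjoin L {x}) {y}" "y \<in> field_adjoin (field_adjoin L {x}) {y}" for x y
    using field_adjoin_incl[of L "{x}"] field_adjoin_incl[of "field_adjoin L {x}" "{y}"] by auto
  have fld: "is_subfield (field_adjoin (field_adjoin L {x}) {y})" for x y
    by (rule is_subfield_field_adjoin)
  have sa: "x \<in> {x. algebraic_over_subfield L x}" if "x \<in> sep_closure L" for x
    using that by (auto simp: sep_closure_def separable_imp_algebraic)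
  show ?thesis
    unfolding is_subfield_def is_subring_def
  proof (intro conjI ballI)
    show "1 \<in> sep_closure L"
      using subring_closed[OF subfield_subring[OF L]] unfolding sep_closure_def
      by (auto intro!: separable_over_subfieldI[OF L, of "[:-1, 1:]"]
          simp: poly_over_pCons poly_over_zero[OF subfield_subring[OF L]] pderiv_pCons)
    fix x assume x: "x \<in> sep_closure L"
    show "inverse x \<in> sep_closure L"
    proof (rule key[OF x x])
      show "inverse x \<in> field_adjoin (field_adjoin L {x}) {x}"
        by (intro subfield_inverse[OF fld] gen)
      show "algebraic_over_subfield L (inverse x)"
        using subfield_inverse[OF alg sa[OF x]] by simp
    qed
    fix y assume y: "y \<in> sep_closure L"
    show "x - y \<in> sep_closure L"
    proof (rule key[OF x y])
      show "x - y \<in> field_adjoin (field_adjoin L {x}) {y}"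
        by (intro subring_diff[OF subfield_subring[OF fld]] gen)
      show "algebraic_over_subfield L (x - y)"
        using subring_diff[OF subfield_subring[OF alg] sa[OF x] sa[OF y]] by simp
    qed
    show "x * y \<in> sep_closure L"
    proof (rule key[OF x y])
      show "x * y \<in> field_adjoin (field_adjoin L {x}) {y}"
        by (intro subring_mult[OF subfield_subring[OF fld]] gen)
      show "algebraic_over_subfield L (x * y)"
        using subring_mult[OF subfield_subring[OF alg] sa[OF x] sa[OF y]] by simp
    qed
  qed
qed

section \<open>Extension of places\<close>

context
  fixes L :: "'a::field set" and P :: "'a \<Rightarrow> 'k::field option"
  assumes P: "place_on L P"
begin

lemma place_subfield: "is_subfield L"
  using P by (simp add: place_on_def)

lemma place_one: "P 1 = Some 1"
  using P by (simp add: place_on_def)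

lemma place_add: "x \<in> L \<Longrightarrow> y \<in> L \<Longrightarrow> P x = Some a \<Longrightarrow> P y = Some b \<Longrightarrow> P (x + y) = Some (a + b)"
  and place_mult: "x \<in> L \<Longrightarrow> y \<in> L \<Longrightarrow> P x = Some a \<Longrightarrow> P y = Some b \<Longrightarrow> P (x * y) = Some (a * b)"
  using P by (auto simp: place_on_def valuation_ring_def residue_def)

lemma place_inverse: "x \<in> L \<Longrightarrow> P x = None \<Longrightarrow> P (inverse x) = Some 0"
  using P by (simp add: place_on_def)

lemma place_zero: "P 0 = Some 0"
proof -
  have 0: "0 \<in> L" by (rule subring_zero[OF subfield_subring[OF place_subfield]])
  \<comment> \<open>Since \<open>inverse 0 = 0\<close>, the value \<open>None\<close> at 0 would
    force the value \<open>Some 0\<close>.\<close>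
  obtain a where a: "P 0 = Some a"
    using place_inverse[OF 0] by (cases "P 0") auto
  have "a = a + a"
    using place_add[OF 0 0 a a] a by simp
  then have "a = 0"
    by (metis add_0_right add_left_cancel)
  with a show ?thesis by simp
qed

lemma place_uminus:
  assumes "x \<in> L" "P x = Some a"
  shows "P (- x) = Some (- a)"
proof -
  note R = subfield_subring[OF place_subfield]
  have m: "- 1 \<in> L" and o: "1 \<in> L" by (auto intro: subring_closed[OF R])
  \<comment> \<open>\<open>- 1\<close> is its own inverse, so the value \<open>None\<close> is
    excluded as it was at 0.\<close>
  obtain b where b: "P (- 1) = Some b"
    using place_inverse[OF m] by (cases "P (- 1)") auto
  have "b = - 1"
    using place_add[OF m o b place_one] place_zero by (simp add: eq_neg_iff_add_eq_0)
  then show ?thesis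
    using place_mult[OF m assms(1) b assms(2)] by simp
qed

lemma place_diff: "x \<in> L \<Longrightarrow> y \<in> L \<Longrightarrow> P x = Some a \<Longrightarrow> P y = Some b \<Longrightarrow> P (x - y) = Some (a - b)"
  using place_add[of x "- y" a "- b"] place_uminus[of y b]
    subring_uminus[OF subfield_subring[OF place_subfield], of y] by simp

lemma is_subring_valuation_ring: "is_subring (valuation_ring L P)"
  using subring_closed[OF subfield_subring[OF place_subfield]] place_one place_diff place_mult
  unfolding is_subring_def valuation_ring_def by fastforce

end

text \<open>Homomorphisms from subrings of \<open>'b\<close> to \<open>'k\<close>, represented by their graphs. The last
  clause makes the relation single-valued.\<close>

definition hom_graph :: "('b::field \<times> 'k::field) set \<Rightarrow> bool" where
  "hom_graph G \<longleftrightarrow> (1, 1) \<in> G \<and>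
     (\<forall>x a y b. (x, a) \<in> G \<longrightarrow> (y, b) \<in> G \<longrightarrow> (x - y, a - b) \<in> G \<and> (x * y, a * b) \<in> G) \<and>
     (\<forall>a. (0, a) \<in> G \<longrightarrow> a = 0)"

text \<open>It is a relation because \<open>G\<close> is only partial. The degree may drop from
  \<open>p\<close> to \<open>p'\<close>, which is what \<open>maximal_hom_graph_shorten\<close>
  exploits.\<close>

definition hom_graph_poly :: "('b::field \<times> 'k::field) set \<Rightarrow> 'b poly \<Rightarrow> 'k poly \<Rightarrow> bool" where
  "hom_graph_poly G p p' \<longleftrightarrow> (\<forall>i. (poly.coeff p i, poly.coeff p' i) \<in> G)"

context
  fixes G :: "('b::field \<times> 'k::field) set"
  assumes G: "hom_graph G"
begin

lemma hom_graph_one: "(1, 1) \<in> G"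
  and hom_graph_diff: "(x, a) \<in> G \<Longrightarrow> (y, b) \<in> G \<Longrightarrow> (x - y, a - b) \<in> G"
  and hom_graph_mult: "(x, a) \<in> G \<Longrightarrow> (y, b) \<in> G \<Longrightarrow> (x * y, a * b) \<in> G"
  and hom_graph_0_left: "(0, a) \<in> G \<Longrightarrow> a = 0"
  using G unfolding hom_graph_def by blast+

lemma hom_graph_zero: "(0, 0) \<in> G"
  using hom_graph_diff[OF hom_graph_one hom_graph_one] by simp

lemma hom_graph_uminus: "(x, a) \<in> G \<Longrightarrow> (- x, - a) \<in> G"
  using hom_graph_diff[OF hom_graph_zero] by force

lemma hom_graph_add: "(x, a) \<in> G \<Longrightarrow> (y, b) \<in> G \<Longrightarrow> (x + y, a + b) \<in> G"
  using hom_graph_diff[OF _ hom_graph_uminus, of x a y b] by simp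

lemma hom_graph_unique: "(x, a) \<in> G \<Longrightarrow> (x, b) \<in> G \<Longrightarrow> a = b"
  using hom_graph_diff[of x a x b] hom_graph_0_left by fastforce

lemma hom_graph_power: "(x, a) \<in> G \<Longrightarrow> (x ^ n, a ^ n) \<in> G"
  by (induction n) (auto intro: hom_graph_one hom_graph_mult)

lemma hom_graph_sum: "(\<And>i. i \<in> I \<Longrightarrow> (f i, g i) \<in> G) \<Longrightarrow> (sum f I, sum g I) \<in> G"
  by (induction I rule: infinite_finite_induct) (auto intro: hom_graph_zero hom_graph_add)

lemma hom_graph_poly_diff:
  "hom_graph_poly G p p' \<Longrightarrow> hom_graph_poly G q q' \<Longrightarrow> hom_graph_poly G (p - q) (p' - q')"
  by (auto simp: hom_graph_poly_def intro: hom_graph_diff)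

lemma hom_graph_poly_mult:
  "hom_graph_poly G p p' \<Longrightarrow> hom_graph_poly G q q' \<Longrightarrow> hom_graph_poly G (p * q) (p' * q')"
  by (auto simp: hom_graph_poly_def coeff_mult intro!: hom_graph_sum hom_graph_mult)

lemma hom_graph_poly_monom:
  "(x, a) \<in> G \<Longrightarrow> hom_graph_poly G (Polynomial.monom x n) (Polynomial.monom a n)"
  by (auto simp: hom_graph_poly_def intro: hom_graph_zero)

lemma is_subring_Range: "is_subring (Range G)"
  unfolding is_subring_def
  using hom_graph_one hom_graph_diff hom_graph_mult by (auto simp: Range_iff; blast)

text \<open>The value \<open>p'(\<alpha>)\<close> is assigned to \<open>p(x)\<close>. The hypothesis
  says that this is single-valued, since for a subring of pairs it is enough to look above
  0.\<close>

lemma hom_graph_adjoin: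
  assumes "\<And>p p'. hom_graph_poly G p p' \<Longrightarrow> poly p x = 0 \<Longrightarrow> poly p' \<alpha> = 0"
  shows "\<exists>G'. hom_graph G' \<and> G \<subseteq> G' \<and> (x, \<alpha>) \<in> G'"
proof (intro exI conjI)
  let ?G = "{(poly p x, poly p' \<alpha>) |p p'. hom_graph_poly G p p'}"
  show GG: "G \<subseteq> ?G"
    using hom_graph_poly_monom[of _ _ 0] by (force simp: poly_monom)
  show "(x, \<alpha>) \<in> ?G"
    using hom_graph_poly_monom[OF hom_graph_one, of 1] by (force simp: poly_monom)
  show "hom_graph ?G"
    unfolding hom_graph_def
  proof (intro conjI allI impI)
    show "(1, 1) \<in> ?G" using GG hom_graph_one by blast
    show "a = 0" if "(0, a) \<in> ?G" for a using that assms by auto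
    fix y a z b assume "(y, a) \<in> ?G" "(z, b) \<in> ?G"
    then obtain p p' q q' where *: "hom_graph_poly G p p'" "hom_graph_poly G q q'"
      "y = poly p x" "a = poly p' \<alpha>" "z = poly q x" "b = poly q' \<alpha>" by auto
    show "(y - z, a - b) \<in> ?G"
      using hom_graph_poly_diff[OF *(1,2)] * by (auto intro!: exI[of _ "p - q"] exI[of _ "p' - q'"])
    show "(y * z, a * b) \<in> ?G"
      using hom_graph_poly_mult[OF *(1,2)] * by (auto intro!: exI[of _ "p * q"] exI[of _ "p' * q'"])
  qed
qed

end

lemma poly_eq_sum_atMost:
  "Polynomial.degree p \<le> n \<Longrightarrow> poly p x = (\<Sum>i\<le>n. poly.coeff p i * x ^ i)"
  for x :: "'a::field"
  unfolding poly_altdef by (intro sum.mono_neutral_left) (auto simp: coeff_eq_0)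

section \<open>Maximal homomorphisms and their valuation rings\<close>

context
  fixes G :: "('b::field \<times> 'k::alg_closed_field) set"
  assumes G: "hom_graph G"
    and maximal: "\<And>G'. hom_graph G' \<Longrightarrow> G \<subseteq> G' \<Longrightarrow> G' = G"
begin

lemma maximal_hom_graph_mem:
  assumes "\<And>p p'. hom_graph_poly G p p' \<Longrightarrow> poly p x = 0 \<Longrightarrow> poly p' \<alpha> = 0"
  shows "(x, \<alpha>) \<in> G"
proof -
  have "\<exists>G'. hom_graph G' \<and> G \<subseteq> G' \<and> (x, \<alpha>) \<in> G'"
    using assms by (intro hom_graph_adjoin[OF G])
  then show ?thesis using maximal by blast
qed

text \<open>The domain of a maximal homomorphism is a local ring: elements with nonzero value are
  units in it. A polynomial relation for \<open>1/x\<close>, multiplied by a power of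
  \<open>x\<close>, becomes a relation in the domain, whose image is the same expression in
  \<open>a\<close>.\<close>

lemma maximal_hom_graph_inverse:
  assumes xa: "(x, a) \<in> G" and a: "a \<noteq> 0"
  shows "(inverse x, inverse a) \<in> G"
proof (rule maximal_hom_graph_mem)
  fix p p' assume p: "hom_graph_poly G p p'" "poly p (inverse x) = 0"
  have x: "x \<noteq> 0" using xa a hom_graph_0_left[OF G] by auto
  define n where "n = max (Polynomial.degree p) (Polynomial.degree p')"
  have refl: "poly r (inverse y) * y ^ n = (\<Sum>i\<le>n. poly.coeff r i * y ^ (n - i))"
    if "Polynomial.degree r \<le> n" "y \<noteq> 0" for r and y :: "'c::field"
    unfolding poly_eq_sum_atMost[OF that(1)] sum_distrib_right
    using that(2) by (intro sum.cong) (auto simp: power_diff field_simps power_inverse)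
  have "((\<Sum>i\<le>n. poly.coeff p i * x ^ (n - i)), (\<Sum>i\<le>n. poly.coeff p' i * a ^ (n - i))) \<in> G"
    using p(1) xa unfolding hom_graph_poly_def
    by (intro hom_graph_sum[OF G] hom_graph_mult[OF G] hom_graph_power[OF G]) auto
  moreover have "(\<Sum>i\<le>n. poly.coeff p i * x ^ (n - i)) = 0"
    using refl[of p x] x p(2) by (simp add: n_def)
  ultimately have "(\<Sum>i\<le>n. poly.coeff p' i * a ^ (n - i)) = 0"
    using hom_graph_0_left[OF G] by simp
  then show "poly p' (inverse a) = 0"
    using refl[of p' a] a by (simp add: n_def)
qed

lemma is_subfield_Range_maximal: "is_subfield (Range G)"
  unfolding is_subfield_def
proof (intro conjI ballI)
  show "is_subring (Range G)" by (rule is_subring_Range[OF G])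
  fix a assume "a \<in> Range G"
  then show "inverse a \<in> Range G"
    using maximal_hom_graph_inverse by (cases "a = 0") auto
qed

text \<open>If no value at \<open>x\<close> is possible, then the images of the polynomials vanishing at \<open>x\<close>
  have no common root, so they generate the unit ideal.\<close>

lemma maximal_hom_graph_unit:
  assumes x: "x \<notin> Domain G"
  shows "\<exists>p. hom_graph_poly G p 1 \<and> poly p x = 0"
proof -
  let ?k = "Range G"
  note R = is_subring_Range[OF G]
  define I where "I = {p'. \<exists>p. hom_graph_poly G p p' \<and> poly p x = 0}"
  have noroot: "\<exists>p'\<in>I. poly p' \<alpha> \<noteq> 0" for \<alpha>
    using maximal_hom_graph_mem[of x \<alpha>] x by (auto simp: I_def)
  have I_over: "p' \<in> poly_over ?k" if "p' \<in> I" for p'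
    using that by (auto simp: I_def hom_graph_poly_def poly_over_def)
  have lift: "\<exists>q. hom_graph_poly G q q'" if q': "q' \<in> poly_over ?k" for q'
  proof -
    have "\<exists>c. (c, poly.coeff q' i) \<in> G" for i
      using q' by (auto simp: poly_over_def)
    then obtain c where c: "\<And>i. (c i, poly.coeff q' i) \<in> G" by metis
    let ?q = "\<Sum>i\<le>Polynomial.degree q'. Polynomial.monom (c i) i"
    have "(poly.coeff ?q i, poly.coeff q' i) \<in> G" for i
      using c[of i] hom_graph_zero[OF G] coeff_eq_0[of q' i]
      by (cases "i \<le> Polynomial.degree q'") (auto simp: coeff_sum)
    then show ?thesis by (auto simp: hom_graph_poly_def)
  qed
  have I_diff: "p' - q' * r' \<in> I" if p': "p' \<in> I" and r': "r' \<in> I" and q': "q' \<in> poly_over ?k" for p' q' r'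
  proof -
    obtain p r q where "hom_graph_poly G p p'" "poly p x = 0" "hom_graph_poly G r r'" "poly r x = 0"
      "hom_graph_poly G q q'"
      using p' r' lift[OF q'] by (auto simp: I_def)
    then show ?thesis
      unfolding I_def by (auto intro!: exI[of _ "p - q * r"] hom_graph_poly_diff[OF G] hom_graph_poly_mult[OF G])
  qed
  have I_mult: "q' * r' \<in> I" if r': "r' \<in> I" and q': "q' \<in> poly_over ?k" for q' r'
    using I_diff[of r' r' "1 - q'"] that poly_over_diff[OF R poly_over_one[OF R] q']
    by (simp add: algebra_simps)
  obtain p0 where "p0 \<in> I" "p0 \<noteq> 0" using noroot[of 0] by force
  \<comment> \<open>An element of least degree generates the ideal \<open>I\<close>, since it can be
    made monic over the field \<open>Range G\<close>.\<close>
  then obtain f where f: "f \<in> I" "f \<noteq> 0"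
    and least: "\<And>g. g \<in> I \<Longrightarrow> g \<noteq> 0 \<Longrightarrow> Polynomial.degree f \<le> Polynomial.degree g"
    using exists_least_iff[of "\<lambda>n. \<exists>p. p \<in> I \<and> p \<noteq> 0 \<and> Polynomial.degree p = n"]
    by (metis linorder_not_less)
  define c where "c = inverse (Polynomial.lead_coeff f)"
  have c: "c \<noteq> 0" "c \<in> ?k"
    using f I_over[OF f(1)] subfield_inverse[OF is_subfield_Range_maximal]
    by (auto simp: c_def poly_over_def)
  define g where "g = [:c:] * f"
  have g: "g \<in> I" "Polynomial.lead_coeff g = 1" "Polynomial.degree g = Polynomial.degree f"
    using f c I_mult[of f "[:c:]"]
    by (auto simp: g_def poly_over_pCons poly_over_zero[OF R]) (simp add: c_def)
  \<comment> \<open>A root of the generator would be a common root of all of \<open>I\<close>; here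
    the algebraic closedness of the value field enters.\<close>
  have "Polynomial.degree g = 0"
  proof (rule ccontr)
    assume "Polynomial.degree g \<noteq> 0"
    then obtain \<alpha> where \<alpha>: "poly g \<alpha> = 0"
      using alg_closed_imp_poly_has_root[of g] by auto
    obtain h where h: "h \<in> I" "poly h \<alpha> \<noteq> 0" using noroot by blast
    obtain q r where qr: "q \<in> poly_over ?k" "r \<in> poly_over ?k" "h = q * g + r"
      "r = 0 \<or> Polynomial.degree r < Polynomial.degree g"
      using poly_over_division[OF R I_over[OF g(1)] g(2) I_over[OF h(1)]] by blast
    have "r = h - q * g" using qr(3) by simp
    then have "r \<in> I" using I_diff h(1) g(1) qr(1) by blast
    then have "r = 0" using least[of r] qr(4) g(3) by fastforce
    then show False using h(2) qr(3) \<alpha> by simp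
  qed
  then have "g = 1"
    using g(2) by (auto elim!: degree_eq_zeroE simp: one_pCons)
  then show ?thesis using g(1) by (auto simp: I_def)
qed

text \<open>A relation \<open>p(x) = 0\<close> with \<open>p\<close> reducing to \<open>1\<close> is shortened by a monic
  relation for \<open>x\<close> obtained from one for \<open>1/x\<close>.\<close>

lemma maximal_hom_graph_shorten:
  assumes x: "x \<noteq> 0" and p: "hom_graph_poly G p 1" "poly p x = 0"
    and q: "hom_graph_poly G q 1" "poly q (inverse x) = 0"
    and deg: "Polynomial.degree q \<le> Polynomial.degree p"
  shows "\<exists>r. hom_graph_poly G r 1 \<and> poly r x = 0 \<and> Polynomial.degree r < Polynomial.degree p"
proof -
  define n where "n = Polynomial.degree p"
  define m where "m = Polynomial.degree q"
  \<comment> \<open>A constant \<open>p\<close> vanishing at \<open>x\<close> is 0, and then the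
    graph would contain the pair \<open>(0, 1)\<close>.\<close>
  have n0: "n > 0"
  proof (rule ccontr)
    assume "\<not> n > 0"
    then obtain a where "p = [:a:]" by (auto simp: n_def elim: degree_eq_zeroE)
    with p have "p = 0" by simp
    then have "(0, poly.coeff 1 0) \<in> G"
      using p(1) unfolding hom_graph_poly_def by (metis coeff_0)
    then show False using hom_graph_0_left[OF G, of 1] by simp
  qed
  have q0: "(poly.coeff q 0, 1) \<in> G" and qi: "(poly.coeff q i, 0) \<in> G" if "i > 0" for i
    using q(1)[unfolded hom_graph_poly_def, rule_format] that
    by (metis lead_coeff_1 degree_1, metis coeff_eq_0 degree_1)
  have q0': "(poly.coeff q 0, 1) \<in> G" using q0[of 1] by simp
  define c where "c = inverse (poly.coeff q 0)"
  have c: "(c, 1) \<in> G" using maximal_hom_graph_inverse[OF q0'] by (simp add: c_def)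
  have q0n: "poly.coeff q 0 \<noteq> 0" using q0' hom_graph_0_left[OF G, of 1] by auto
  \<comment> \<open>\<open>u\<close> is the reciprocal polynomial of \<open>q\<close> divided by the
    constant coefficient of \<open>q\<close>, a unit. It is monic of degree \<open>m\<close> and
    vanishes at \<open>x\<close>; \<open>u'\<close> is its image.\<close>
  define u where "u = (\<Sum>i\<le>m. Polynomial.monom (c * poly.coeff q i) (m - i))"
  define u' where "u' = (\<Sum>i\<le>m. Polynomial.monom (1 * poly.coeff (1::'k poly) i) (m - i))"
  have coeff_u': "hom_graph_poly G u u'"
    unfolding hom_graph_poly_def
  proof
    fix k
    have "(poly.coeff (Polynomial.monom (c * poly.coeff q i) (m - i)) k,
           poly.coeff (Polynomial.monom (1 * poly.coeff (1::'k poly) i) (m - i)) k) \<in> G" for i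
      using hom_graph_poly_monom[OF G hom_graph_mult[OF G c], of "poly.coeff q i" "poly.coeff 1 i" "m - i"]
        q(1) by (simp add: hom_graph_poly_def)
    then show "(poly.coeff u k, poly.coeff u' k) \<in> G"
      unfolding u_def u'_def coeff_sum by (intro hom_graph_sum[OF G])
  qed
  have coeff_u: "poly.coeff u k = (\<Sum>i\<le>m. if m - i = k then c * poly.coeff q i else 0)" for k
    by (simp add: u_def coeff_sum)
  have um: "poly.coeff u m = 1"
  proof -
    have "poly.coeff u m = (\<Sum>i\<in>{0}. if m - i = m then c * poly.coeff q i else 0)"
      unfolding coeff_u by (intro sum.mono_neutral_right) auto
    then show ?thesis using q0n by (simp add: c_def)
  qed
  have uk: "poly.coeff u k = 0" if "k > m" for k
    unfolding coeff_u using that by (intro sum.neutral) auto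
  have ux: "poly u x = 0"
  proof -
    have "poly u x = c * x ^ m * poly q (inverse x)"
      unfolding u_def poly_sum poly_eq_sum_atMost[of q m, OF eq_refl, OF m_def[symmetric]] sum_distrib_left
      using x by (intro sum.cong) (auto simp: poly_monom power_diff field_simps power_inverse)
    then show ?thesis using q(2) by simp
  qed
  \<comment> \<open>The top coefficient of \<open>p\<close> has value 0, because \<open>p\<close>
    reduces to 1 and \<open>n > 0\<close>; subtracting this multiple of \<open>u\<close> therefore
    leaves the reduction unchanged.\<close>
  define r where "r = p - Polynomial.monom (poly.coeff p n) (n - m) * u"
  have mn: "m \<le> n" using deg by (simp add: m_def n_def)
  have "(poly.coeff p n, 0) \<in> G"
    using p(1)[unfolded hom_graph_poly_def, rule_format, of n] n0 by simp
  then have "hom_graph_poly G r (1 - Polynomial.monom 0 (n - m) * u')"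
    unfolding r_def
    by (intro hom_graph_poly_diff[OF G] hom_graph_poly_mult[OF G] hom_graph_poly_monom[OF G] p(1) coeff_u')
  then have r1: "hom_graph_poly G r 1" by simp
  have "poly.coeff r k = 0" if k: "k \<ge> n" for k
  proof (cases "k = n")
    case True
    then show ?thesis using mn um by (simp add: r_def coeff_monom_mult)
  next
    case False
    then show ?thesis
      using k mn uk[of "k - (n - m)"] coeff_eq_0[of p k] by (simp add: r_def coeff_monom_mult n_def)
  qed
  then have "Polynomial.degree r \<le> n - 1"
    by (intro degree_le) (simp add: n0)
  then have "Polynomial.degree r < n" using n0 by simp
  then show ?thesis
    using r1 p(2) ux by (auto simp: r_def n_def)
qed

text \<open>Chevalley's argument: if both \<open>x\<close> and \<open>1/x\<close> were outside the
  domain, each would satisfy a relation with reduction 1. For two such relations of least degree,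
  the one of larger degree could be shortened by means of the other.\<close>

lemma maximal_hom_graph_valuation: "x \<in> Domain G \<or> inverse x \<in> Domain G"
proof (rule ccontr)
  assume neg: "\<not> (x \<in> Domain G \<or> inverse x \<in> Domain G)"
  then have x: "x \<noteq> 0" using hom_graph_zero[OF G] by auto
  define Q where "Q y p \<longleftrightarrow> hom_graph_poly G p 1 \<and> poly p y = 0" for y p
  have least: "\<exists>p. Q y p \<and> (\<forall>q. Q y q \<longrightarrow> Polynomial.degree p \<le> Polynomial.degree q)"
    if "y \<notin> Domain G" for y
  proof -
    have "\<exists>p. Q y p" using maximal_hom_graph_unit[OF that] by (simp add: Q_def)
    then show ?thesis
      using exists_least_iff[of "\<lambda>n. \<exists>p. Q y p \<and> Polynomial.degree p = n"]
      by (metis linorder_not_less)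
  qed
  obtain p q where p: "Q x p" "\<forall>q. Q x q \<longrightarrow> Polynomial.degree p \<le> Polynomial.degree q"
    and q: "Q (inverse x) q" "\<forall>r. Q (inverse x) r \<longrightarrow> Polynomial.degree q \<le> Polynomial.degree r"
    using least[of x] least[of "inverse x"] neg by blast
  show False
  proof (cases "Polynomial.degree q \<le> Polynomial.degree p")
    case True
    then show False
      using maximal_hom_graph_shorten[of x p q] x p q unfolding Q_def by fastforce
  next
    case False
    then show False
      using maximal_hom_graph_shorten[of "inverse x" q p] x p q unfolding Q_def by fastforce
  qed
qed

end

text \<open>Zorn's lemma for graphs ordered by inclusion. Two pairs from a chain lie in a common
  member, and the clause at 0 is a condition on single pairs, so unions stay admissible.\<close>

lemma hom_graph_maximal_exists:
  fixes G0 :: "('b::field \<times> 'k::field) set"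
  assumes "hom_graph G0"
  shows "\<exists>G. hom_graph G \<and> G0 \<subseteq> G \<and> (\<forall>G'. hom_graph G' \<longrightarrow> G \<subseteq> G' \<longrightarrow> G' = G)"
proof -
  define A where "A = {G :: ('b \<times> 'k) set. hom_graph G \<and> G0 \<subseteq> G}"
  have "\<exists>m\<in>A. \<forall>g\<in>A. m \<subseteq> g \<longrightarrow> g = m"
  proof (rule subset_Zorn_nonempty)
    show "A \<noteq> {}" using assms by (auto simp: A_def)
    fix C assume C: "C \<noteq> {}" "subset.chain A C"
    then have sub: "C \<subseteq> A" and tot: "\<And>g h. g \<in> C \<Longrightarrow> h \<in> C \<Longrightarrow> g \<subseteq> h \<or> h \<subseteq> g"
      by (auto simp: subset_chain_def)
    note sub = sub[unfolded A_def]
    have "hom_graph (\<Union>C)"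
      unfolding hom_graph_def
    proof (intro conjI allI impI)
      show "(1, 1) \<in> \<Union>C" using C sub hom_graph_one by blast
      show "a = 0" if "(0, a) \<in> \<Union>C" for a
        using that sub hom_graph_0_left by blast
      fix x a y b assume "(x, a) \<in> \<Union>C" "(y, b) \<in> \<Union>C"
      then obtain g where g: "g \<in> C" "(x, a) \<in> g" "(y, b) \<in> g" using tot by blast
      then have "hom_graph g" using sub by auto
      from hom_graph_diff[OF this g(2,3)] hom_graph_mult[OF this g(2,3)] g(1)
      show "(x - y, a - b) \<in> \<Union>C" "(x * y, a * b) \<in> \<Union>C" by auto
    qed
    then show "\<Union>C \<in> A" using C sub by (auto simp: A_def)
  qed
  then obtain M where M: "M \<in> A" "\<And>g. g \<in> A \<Longrightarrow> M \<subseteq> g \<Longrightarrow> g = M" by blast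
  show ?thesis
  proof (intro exI[of _ M] conjI allI impI)
    fix g assume "hom_graph g" "M \<subseteq> g"
    with M show "g = M" by (auto simp: A_def)
  qed (use M(1) in \<open>auto simp: A_def\<close>)
qed

text \<open>The domain of a maximal graph above that of \<open>P\<close> is a valuation ring. The
  infinite values are checked separately: where \<open>P\<close> is infinite, the inverse has value
  0 in the graph, so the element itself cannot lie in the domain.\<close>

theorem place_extension_alg_closure:
  fixes P :: "'a::field \<Rightarrow> 'k::field option"
  assumes P: "place_on UNIV P"
  shows "\<exists>Q. place_on UNIV Q \<and> place_extends Q P"
proof -
  define G0 where "G0 = {(to_ac x, to_ac a) |x a. P x = Some a}"
  have "hom_graph G0"
    unfolding hom_graph_def
  proof (intro conjI allI impI)
    show "(1, 1) \<in> G0" using place_one[OF P] by (auto simp: G0_def intro!: exI[of _ 1])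
    show "a = 0" if "(0, a) \<in> G0" for a
      using that place_zero[OF P] by (auto simp: G0_def)
    fix x a y b assume "(x, a) \<in> G0" "(y, b) \<in> G0"
    then obtain x' a' y' b' where *: "x = to_ac x'" "a = to_ac a'" "y = to_ac y'" "b = to_ac b'"
      "P x' = Some a'" "P y' = Some b'" by (auto simp: G0_def)
    show "(x - y, a - b) \<in> G0" "(x * y, a * b) \<in> G0"
      using place_diff[OF P _ _ *(5,6)] place_mult[OF P _ _ *(5,6)] *(1-4)
      unfolding G0_def by (metis (mono_tags, lifting) UNIV_I mem_Collect_eq to_ac_diff to_ac_mult)+
  qed
  then obtain G where G: "hom_graph G" "G0 \<subseteq> G"
    and max: "\<And>G'. hom_graph G' \<Longrightarrow> G \<subseteq> G' \<Longrightarrow> G' = G"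
    using hom_graph_maximal_exists by blast
  define Q where "Q x = (if x \<in> Domain G then Some (THE a. (x, a) \<in> G) else None)" for x
  have Q_eq: "Q x = Some a" if "(x, a) \<in> G" for x a
    using that hom_graph_unique[OF G(1)] by (auto simp: Q_def)
  have Q_D: "(x, a) \<in> G" if "Q x = Some a" for x a
  proof -
    obtain b where "(x, b) \<in> G"
      using \<open>Q x = Some a\<close> by (auto simp: Q_def split: if_splits)
    with Q_eq[OF this] that show ?thesis by simp
  qed
  have Q_None: "Q (inverse x) = Some 0" if "Q x = None" for x
  proof -
    have "x \<notin> Domain G" using that by (auto simp: Q_def split: if_splits)
    then obtain b where b: "(inverse x, b) \<in> G"
      using maximal_hom_graph_valuation[OF G(1) max] by blast
    \<comment> \<open>Otherwise \<open>1/x\<close> would be a unit of the domain, and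
      \<open>x\<close> would lie in it.\<close>
    have "b = 0"
    proof (rule ccontr)
      assume "b \<noteq> 0"
      then have "(x, inverse b) \<in> G"
        using maximal_hom_graph_inverse[OF G(1) max b] by simp
      then show False using \<open>x \<notin> Domain G\<close> by auto
    qed
    then show ?thesis using Q_eq b by simp
  qed
  have "place_on UNIV Q"
    unfolding place_on_def valuation_ring_def residue_def
  proof (intro conjI ballI impI)
    show "is_subfield UNIV" by (simp add: is_subfield_def is_subring_def)
    show "Q 1 = Some 1" by (rule Q_eq[OF hom_graph_one[OF G(1)]])
    show "Q (inverse x) = Some 0" if "Q x = None" for x using Q_None that .
    fix x y assume "x \<in> {x \<in> UNIV. Q x \<noteq> None}" "y \<in> {x \<in> UNIV. Q x \<noteq> None}"
    then obtain a b where ab: "Q x = Some a" "Q y = Some b" by auto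
    show "Q (x + y) = Some (the (Q x) + the (Q y))"
      using Q_eq[OF hom_graph_add[OF G(1) Q_D[OF ab(1)] Q_D[OF ab(2)]]] ab by simp
    show "Q (x * y) = Some (the (Q x) * the (Q y))"
      using Q_eq[OF hom_graph_mult[OF G(1) Q_D[OF ab(1)] Q_D[OF ab(2)]]] ab by simp
  qed
  moreover have "place_extends Q P"
    unfolding place_extends_def
  proof
    fix x
    show "Q (to_ac x) = map_option to_ac (P x)"
    proof (cases "P x")
      case (Some a)
      then have "(to_ac x, to_ac a) \<in> G" using G(2) by (auto simp: G0_def)
      then show ?thesis using Some Q_eq by simp
    next
      case None
      then have "P (inverse x) = Some 0" using place_inverse[OF P] by simp
      then have "(to_ac (inverse x), to_ac 0) \<in> G0"
        unfolding G0_def by blast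
      then have inv: "(inverse (to_ac x), 0) \<in> G"
        using G(2) by auto
      have x: "x \<noteq> 0" using None place_zero[OF P] by auto
      have "to_ac x \<notin> Domain G"
      proof
        assume "to_ac x \<in> Domain G"
        then obtain b where "(to_ac x, b) \<in> G" by auto
        from hom_graph_mult[OF G(1) this inv] have "(1, 0) \<in> G" using x by simp
        then show False
          using hom_graph_unique[OF G(1) _ hom_graph_one[OF G(1)], of 0] by simp
      qed
      then show ?thesis using None by (simp add: Q_def)
    qed
  qed
  ultimately show ?thesis by blast
qed

section \<open>Multivariate polynomials\<close>

text \<open>The inner product of \<open>mpol_eval\<close>, named so that its multiplicativity can be
  stated.\<close>

definition monomial_value :: "('v \<Rightarrow> 'a::comm_monoid_mult) \<Rightarrow> ('v \<Rightarrow>\<^sub>0 nat) \<Rightarrow> 'a" where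
  "monomial_value g m = (\<Prod>v\<in>Poly_Mapping.keys m. g v ^ Poly_Mapping.lookup m v)"

lemma monomial_value_superset:
  assumes "finite V" "Poly_Mapping.keys m \<subseteq> V"
  shows "monomial_value g m = (\<Prod>v\<in>V. g v ^ Poly_Mapping.lookup m v)"
  unfolding monomial_value_def
  using assms by (intro prod.mono_neutral_left) (auto simp: in_keys_iff)

lemma monomial_value_zero: "monomial_value g 0 = 1"
  by (simp add: monomial_value_def)

lemma monomial_value_add: "monomial_value g (m + m') = monomial_value g m * monomial_value g m'"
proof -
  let ?V = "Poly_Mapping.keys m \<union> Poly_Mapping.keys m'"
  have "Poly_Mapping.keys (m + m') \<subseteq> ?V" by (rule keys_add)
  then show ?thesis
    by (simp add: monomial_value_superset[of ?V] lookup_add power_add prod.distrib)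
qed

lemma mpol_eval_superset:
  assumes "finite M" "Poly_Mapping.keys p \<subseteq> M"
  shows "mpol_eval p g = (\<Sum>m\<in>M. Poly_Mapping.lookup p m * monomial_value g m)"
  unfolding mpol_eval_def monomial_value_def
  using assms by (intro sum.mono_neutral_left) (auto simp: in_keys_iff)

lemma mpol_eval_single: "mpol_eval (Poly_Mapping.single m c) g = c * monomial_value g m"
  by (subst mpol_eval_superset[of "{m}"]) auto

lemma mpol_eval_zero: "mpol_eval 0 g = 0"
  by (simp add: mpol_eval_def)

lemma mpol_eval_add: "mpol_eval (p + q) g = mpol_eval p g + mpol_eval q g"
proof -
  let ?M = "Poly_Mapping.keys p \<union> Poly_Mapping.keys q"
  have "Poly_Mapping.keys (p + q) \<subseteq> ?M" by (rule keys_add)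
  then show ?thesis
    by (simp add: mpol_eval_superset[of ?M] lookup_add distrib_right sum.distrib)
qed

lemma mpol_eval_sum: "mpol_eval (\<Sum>i\<in>I. f i) g = (\<Sum>i\<in>I. mpol_eval (f i) g)"
  by (induction I rule: infinite_finite_induct) (auto simp: mpol_eval_zero mpol_eval_add)

context
  fixes R :: "'a::field set"
  assumes R: "is_subring R"
begin

lemma mpol_over_single: "c \<in> R \<Longrightarrow> Poly_Mapping.keys m \<subseteq> V \<Longrightarrow> Poly_Mapping.single m c \<in> mpol_over R V"
  using subring_zero[OF R] by (auto simp: mpol_over_def lookup_single when_def)

lemma mpol_over_add: "p \<in> mpol_over R V \<Longrightarrow> q \<in> mpol_over R V \<Longrightarrow> p + q \<in> mpol_over R V"
  using keys_add[of p q] by (fastforce simp: mpol_over_def lookup_add intro: subring_add[OF R])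

lemma mpol_over_sum: "(\<And>i. i \<in> I \<Longrightarrow> f i \<in> mpol_over R V) \<Longrightarrow> sum f I \<in> mpol_over R V"
proof (induction I rule: infinite_finite_induct)
  case (insert i I)
  then show ?case by (simp add: mpol_over_add)
qed (simp_all add: mpol_over_def subring_zero[OF R])

text \<open>The values form a subring containing \<open>R\<close> and \<open>T\<close>. Differences
  and products are assembled as explicit sums of monomials, so that the membership of the
  coefficients and the value can both be read off termwise.\<close>

lemma ring_adjoin_mpol_eval:
  "ring_adjoin R T \<subseteq> {mpol_eval p (\<lambda>t. t) |p. p \<in> mpol_over R T}" (is "_ \<subseteq> ?A")
proof (rule ring_adjoin_least)
  have I: "mpol_eval p (\<lambda>t. t) \<in> ?A" if "p \<in> mpol_over R T" for p using that by blast
  show "R \<subseteq> ?A"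
  proof
    fix c assume "c \<in> R"
    then show "c \<in> ?A"
      using I[OF mpol_over_single[of c 0 T]] by (simp add: mpol_eval_single monomial_value_zero)
  qed
  show "T \<subseteq> ?A"
  proof
    fix t assume "t \<in> T"
    then show "t \<in> ?A"
      using I[OF mpol_over_single[of 1 "Poly_Mapping.single t 1" T]] subring_one[OF R]
      by (simp add: mpol_eval_single monomial_value_def)
  qed
  show "is_subring ?A"
    unfolding is_subring_def
  proof (intro conjI ballI)
    show "1 \<in> ?A" using \<open>R \<subseteq> ?A\<close> subring_one[OF R] by blast
    fix x y assume "x \<in> ?A" "y \<in> ?A"
    then obtain p q where pq: "p \<in> mpol_over R T" "q \<in> mpol_over R T"
      "x = mpol_eval p (\<lambda>t. t)" "y = mpol_eval q (\<lambda>t. t)" by blast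
    have coeffs: "Poly_Mapping.lookup p m \<in> R" "Poly_Mapping.lookup q m \<in> R"
      "m \<in> Poly_Mapping.keys p \<Longrightarrow> Poly_Mapping.keys m \<subseteq> T"
      "m \<in> Poly_Mapping.keys q \<Longrightarrow> Poly_Mapping.keys m \<subseteq> T" for m
      using pq by (auto simp: mpol_over_def)
    have x: "x = (\<Sum>m\<in>Poly_Mapping.keys p. Poly_Mapping.lookup p m * monomial_value (\<lambda>t. t) m)"
      and y: "y = (\<Sum>m\<in>Poly_Mapping.keys q. Poly_Mapping.lookup q m * monomial_value (\<lambda>t. t) m)"
      using pq by (simp_all add: mpol_eval_superset)
    let ?d = "p + (\<Sum>m\<in>Poly_Mapping.keys q. Poly_Mapping.single m (- Poly_Mapping.lookup q m))"
    have d: "?d \<in> mpol_over R T"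
      using pq coeffs by (intro mpol_over_add mpol_over_sum mpol_over_single subring_uminus[OF R]) auto
    have de: "mpol_eval ?d (\<lambda>t. t) = x - y"
      by (simp add: pq(3) y mpol_eval_add mpol_eval_sum mpol_eval_single sum_negf)
    show "x - y \<in> ?A" using I[OF d] unfolding de .
    let ?m = "\<Sum>m\<in>Poly_Mapping.keys p. \<Sum>m'\<in>Poly_Mapping.keys q.
      Poly_Mapping.single (m + m') (Poly_Mapping.lookup p m * Poly_Mapping.lookup q m')"
    have "Poly_Mapping.keys (m + m') \<subseteq> T"
      if "m \<in> Poly_Mapping.keys p" "m' \<in> Poly_Mapping.keys q" for m m'
      using keys_add[of m m'] coeffs(3)[OF that(1)] coeffs(4)[OF that(2)] by blast
    then have m: "?m \<in> mpol_over R T"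
      using coeffs by (intro mpol_over_sum mpol_over_single subring_mult[OF R]) auto
    have me: "mpol_eval ?m (\<lambda>t. t) = x * y"
      unfolding x y mpol_eval_sum mpol_eval_single sum_product monomial_value_add
      by (intro sum.cong refl) (simp add: mult_ac)
    show "x * y \<in> ?A" using I[OF m] unfolding me .
  qed
qed

end

text \<open>A linear relation between elements of \<open>K(T)\<close> with coefficients \<open>s\<close> such that
  \<open>s ^ q \<in> K\<close> becomes, after raising it to the \<open>q\<close>-th power, an algebraic relation
  over \<open>K\<close> between the elements of \<open>T\<close>.\<close>

lemma frobenius_disjoint_transcendental:
  fixes K :: "'a::field set"
  assumes K: "is_subfield K" and T: "algebraically_independent K T"
  shows "frobenius_disjoint (to_ac ` K) (to_ac ` field_adjoin K T)"
  unfolding frobenius_disjoint_def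
proof (intro allI impI, elim conjE)
  fix S :: "'a alg_closure set" and n
  define q where "q = max 1 CHAR('a) ^ n"
  have q: "q = max 1 CHAR('a alg_closure) ^ n" by (simp add: q_def)
  have q0: "q > 0" by (simp add: q_def less_max_iff_disj)
  note R = subfield_subring[OF K]
  assume fin: "finite S" and "\<forall>s\<in>S. s ^ (max 1 CHAR('a alg_closure) ^ n) \<in> to_ac ` K"
    and indep: "lin_indep_over (to_ac ` K) S"
  then have "\<forall>s\<in>S. \<exists>k. k \<in> K \<and> s ^ q = to_ac k" by (auto simp: q)
  then obtain \<kappa> where \<kappa>: "\<And>s. s \<in> S \<Longrightarrow> \<kappa> s \<in> K \<and> s ^ q = to_ac (\<kappa> s)" by metis
  have "lin_indep_over (to_ac ` ring_adjoin K T) S"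
    unfolding lin_indep_over_def
  proof (intro allI impI, elim conjE)
    fix c assume c: "\<forall>s\<in>S. c s \<in> to_ac ` ring_adjoin K T" and sum0: "(\<Sum>s\<in>S. c s * s) = 0"
    have "\<forall>s\<in>S. \<exists>p. p \<in> mpol_over K T \<and> c s = to_ac (mpol_eval p (\<lambda>t. t))"
      using c ring_adjoin_mpol_eval[OF R, of T] by blast
    then obtain p where p: "\<And>s. s \<in> S \<Longrightarrow> p s \<in> mpol_over K T \<and> c s = to_ac (mpol_eval (p s) (\<lambda>t. t))"
      by metis
    define M where "M = (\<Union>s\<in>S. Poly_Mapping.keys (p s))"
    have finM: "finite M" using fin by (simp add: M_def)
    \<comment> \<open>Under \<open>to_ac\<close> this is the \<open>q\<close>-th power of the
      coefficient of the monomial \<open>m\<close> in the relation, computed inside \<open>K\<close>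
      by way of \<open>s ^ q = to_ac (\<kappa> s)\<close>.\<close>
    define k where "k m = (\<Sum>s\<in>S. \<kappa> s * Poly_Mapping.lookup (p s) m ^ q)" for m
    have kK: "k m \<in> K" for m
      using \<kappa> p unfolding k_def mpol_over_def
      by (intro subring_sum[OF R] subring_mult[OF R] subring_power[OF R]) auto
    \<comment> \<open>Multiplying all exponents by \<open>q\<close> raises the monomial to the
      \<open>q\<close>-th power; the witness is the \<open>q\<close>-fold sum of
      \<open>m\<close>.\<close>
    have scale: "\<exists>m'. (\<forall>v. Poly_Mapping.lookup m' v = q * Poly_Mapping.lookup m v) \<and>
        monomial_value (\<lambda>t. t) m' = monomial_value (\<lambda>t. t) m ^ q" for m :: "'a \<Rightarrow>\<^sub>0 nat"
    proof (intro exI conjI allI)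
      show "Poly_Mapping.lookup (\<Sum>i<q. m) v = q * Poly_Mapping.lookup m v" for v
        unfolding lookup_sum by simp
      have "monomial_value (\<lambda>t. t) (\<Sum>i<j. m) = monomial_value (\<lambda>t. t) m ^ j" for j
        by (induction j)
          (auto simp: monomial_value_zero monomial_value_add mult.commute simp del: sum_constant)
      then show "monomial_value (\<lambda>t. t) (\<Sum>i<q. m) = monomial_value (\<lambda>t. t) m ^ q" .
    qed
    then obtain sc :: "('a \<Rightarrow>\<^sub>0 nat) \<Rightarrow> ('a \<Rightarrow>\<^sub>0 nat)"
      where sc: "\<And>m v. Poly_Mapping.lookup (sc m) v = q * Poly_Mapping.lookup m v"
        "\<And>m. monomial_value (\<lambda>t. t) (sc m) = monomial_value (\<lambda>t. t) m ^ q"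
      by metis
    have sc_inj: "m = m'" if "sc m = sc m'" for m m'
      using arg_cong[OF that, of Poly_Mapping.lookup] q0 by (intro poly_mapping_eqI) (metis sc(1) mult_cancel1 not_gr_zero)
    define r where "r = (\<Sum>m\<in>M. Poly_Mapping.single (sc m) (k m))"
    have "Poly_Mapping.keys (sc m) \<subseteq> T" if "m \<in> M" for m
    proof -
      have "Poly_Mapping.keys m \<subseteq> T"
        using that p by (force simp: M_def mpol_over_def)
      then show ?thesis by (auto simp: in_keys_iff sc)
    qed
    then have "r \<in> mpol_over K T"
      unfolding r_def using kK by (intro mpol_over_sum[OF R] mpol_over_single[OF R])
    moreover have "mpol_eval r (\<lambda>t. t) = 0"
    proof -
      have eval: "mpol_eval (p s) (\<lambda>t. t) ^ q =
          (\<Sum>m\<in>M. Poly_Mapping.lookup (p s) m ^ q * monomial_value (\<lambda>t. t) m ^ q)" if "s \<in> S" for s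
      proof -
        have "mpol_eval (p s) (\<lambda>t. t) = (\<Sum>m\<in>M. Poly_Mapping.lookup (p s) m * monomial_value (\<lambda>t. t) m)"
          using that finM by (intro mpol_eval_superset) (auto simp: M_def)
        then show ?thesis
          unfolding q_def by (simp only: frobenius_sum power_mult_distrib)
      qed
      have "mpol_eval r (\<lambda>t. t) = (\<Sum>m\<in>M. \<Sum>s\<in>S. \<kappa> s * (Poly_Mapping.lookup (p s) m ^ q * monomial_value (\<lambda>t. t) m ^ q))"
        by (simp add: r_def mpol_eval_sum mpol_eval_single sc(2) k_def sum_distrib_right mult.assoc)
      also have "\<dots> = (\<Sum>s\<in>S. \<kappa> s * mpol_eval (p s) (\<lambda>t. t) ^ q)"
        by (subst sum.swap) (simp add: eval sum_distrib_left)
      finally have "to_ac (mpol_eval r (\<lambda>t. t)) = (\<Sum>s\<in>S. to_ac (\<kappa> s) * to_ac (mpol_eval (p s) (\<lambda>t. t)) ^ q)"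
        by (simp add: to_ac_sum)
      also have "\<dots> = (\<Sum>s\<in>S. (c s * s) ^ q)"
        using p \<kappa> by (intro sum.cong) (auto simp: power_mult_distrib mult.commute)
      also have "\<dots> = (\<Sum>s\<in>S. c s * s) ^ q"
        unfolding q by (rule frobenius_sum[symmetric])
      finally show ?thesis using sum0 q0 by (simp add: power_0_left)
    qed
    ultimately have r0: "r = 0"
      using T by (auto simp: algebraically_independent_def)
    have k0: "k m = 0" if "m \<in> M" for m
    proof -
      have "Poly_Mapping.lookup r (sc m) = (\<Sum>m'\<in>M. if m' = m then k m' else 0)"
        unfolding r_def lookup_sum by (intro sum.cong) (auto simp: lookup_single when_def dest: sc_inj)
      then show ?thesis using r0 that finM by simp
    qed
    \<comment> \<open>Since \<open>q\<close>-th powers vanish only at 0, \<open>k m = 0\<close>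
      yields for each monomial a relation over \<open>K\<close> between the elements of
      \<open>S\<close>.\<close>
    have e0: "(\<Sum>s\<in>S. to_ac (Poly_Mapping.lookup (p s) m) * s) = 0" if "m \<in> M" for m
    proof -
      have "(\<Sum>s\<in>S. to_ac (Poly_Mapping.lookup (p s) m) * s) ^ q =
          (\<Sum>s\<in>S. (to_ac (Poly_Mapping.lookup (p s) m) * s) ^ q)"
        unfolding q by (rule frobenius_sum)
      also have "\<dots> = to_ac (k m)"
        unfolding k_def to_ac_sum using \<kappa> by (intro sum.cong) (auto simp: power_mult_distrib)
      finally show ?thesis using k0[OF that] q0 by simp
    qed
    show "\<forall>s\<in>S. c s = 0"
    proof
      fix s assume s: "s \<in> S"
      have "Poly_Mapping.lookup (p s) m = 0" if "m \<in> M" for m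
      proof -
        have "to_ac (Poly_Mapping.lookup (p s) m) = 0"
        proof (rule lin_indep_overD[OF indep _ e0[OF that] s])
          show "to_ac (Poly_Mapping.lookup (p s) m) \<in> to_ac ` K" if "s \<in> S" for s
            using p[OF that] by (auto simp: mpol_over_def)
        qed
        then show ?thesis by simp
      qed
      moreover have "mpol_eval (p s) (\<lambda>t. t) = (\<Sum>m\<in>M. Poly_Mapping.lookup (p s) m * monomial_value (\<lambda>t. t) m)"
        using s finM by (intro mpol_eval_superset) (auto simp: M_def)
      ultimately show "c s = 0" using p[OF s] by simp
    qed
  qed
  then show "lin_indep_over (to_ac ` field_adjoin K T) S"
  proof (rule lin_indep_over_fractions[rotated 2])
    show "is_subring (to_ac ` ring_adjoin K T)"
      using is_subring_ring_adjoin[of K T] unfolding is_subring_def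
      by (auto simp flip: to_ac_diff to_ac_mult to_ac_1)
    fix y assume "y \<in> to_ac ` field_adjoin K T"
    then obtain x where x: "y = to_ac x" "x \<in> field_adjoin K T" by auto
    obtain a b where ab: "a \<in> ring_adjoin K T" "b \<in> ring_adjoin K T" "b \<noteq> 0" "x = a / b"
      using field_adjoin_fraction[OF x(2)] by blast
    then show "\<exists>a\<in>to_ac ` ring_adjoin K T. \<exists>b\<in>to_ac ` ring_adjoin K T. b \<noteq> 0 \<and> y = a / b"
      using x(1) by (intro bexI[of _ "to_ac a"] bexI[of _ "to_ac b"]) auto
  qed (rule fin)
qed

text \<open>The variables after \<open>i\<close> do not occur and those before it are replaced by
  values in \<open>A\<close>, so \<open>f\<close> becomes a polynomial in one variable over
  \<open>A\<close>. This substitution commutes with the derivative in variable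
  \<open>i\<close>.\<close>

lemma mpol_univariate:
  fixes f :: "(nat, 'a::field) mpol"
  assumes A: "is_subring A" and f: "f \<in> mpol_over A {..<n}" and i: "i < n"
    and occ: "\<And>j. i < j \<Longrightarrow> j < n \<Longrightarrow> \<not> occurs_in j f"
    and \<eta>: "\<And>j. j < i \<Longrightarrow> \<eta> j \<in> A"
  shows "\<exists>g\<in>poly_over A. poly g (\<eta> i) = mpol_eval f \<eta> \<and>
           poly (pderiv g) (\<eta> i) = mpol_eval (partial_deriv i f) \<eta>"
proof -
  define c where "c m = Poly_Mapping.lookup f m * (\<Prod>j<i. \<eta> j ^ Poly_Mapping.lookup m j)" for m
  define g where "g = (\<Sum>m\<in>Poly_Mapping.keys f. Polynomial.monom (c m) (Poly_Mapping.lookup m i))"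
  have keys: "Poly_Mapping.keys m \<subseteq> insert i {..<i}" if m: "m \<in> Poly_Mapping.keys f" for m
  proof
    fix j assume j: "j \<in> Poly_Mapping.keys m"
    then have "j < n" using f m by (auto simp: mpol_over_def)
    moreover have "occurs_in j f" using j m by (auto simp: occurs_in_def)
    ultimately show "j \<in> insert i {..<i}" using occ[of j] by (cases j i rule: linorder_cases) auto
  qed
  have mv: "monomial_value \<eta> m = \<eta> i ^ Poly_Mapping.lookup m i * (\<Prod>j<i. \<eta> j ^ Poly_Mapping.lookup m j)"
    if "Poly_Mapping.keys m \<subseteq> insert i {..<i}" for m
    by (subst monomial_value_superset[OF _ that]) auto
  have "g \<in> poly_over A"
    unfolding g_def c_def using \<eta> f
    by (intro poly_over_sum[OF A] poly_over_monom[OF A] subring_mult[OF A] subring_prod[OF A]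
        subring_power[OF A]) (auto simp: mpol_over_def)
  moreover have "poly g (\<eta> i) = mpol_eval f \<eta>"
    unfolding g_def poly_sum mpol_eval_superset[OF finite_keys order_refl]
    using keys by (intro sum.cong) (auto simp: poly_monom c_def mv mult_ac)
  moreover have "poly (pderiv g) (\<eta> i) = mpol_eval (partial_deriv i f) \<eta>"
  proof -
    have "pderiv g = (\<Sum>m\<in>Poly_Mapping.keys f. pderiv (Polynomial.monom (c m) (Poly_Mapping.lookup m i)))"
      unfolding g_def by (induction rule: infinite_finite_induct) (auto simp: pderiv_add)
    \<comment> \<open>If the exponent of variable \<open>i\<close> is 0, the truncated subtraction
      is harmless, because the factor \<open>of_nat 0\<close> annihilates both sides.\<close>
    moreover have "of_nat (Poly_Mapping.lookup m i) * c m * \<eta> i ^ (Poly_Mapping.lookup m i - 1) =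
        of_nat (Poly_Mapping.lookup m i) * Poly_Mapping.lookup f m *
        monomial_value \<eta> (m - Poly_Mapping.single i 1)" if m: "m \<in> Poly_Mapping.keys f" for m
    proof -
      have lk: "Poly_Mapping.lookup (m - Poly_Mapping.single i 1) j =
          Poly_Mapping.lookup m j - (if j = i then 1 else 0)" for j
        by (simp add: minus_poly_mapping.rep_eq lookup_single when_def)
      have "Poly_Mapping.keys (m - Poly_Mapping.single i 1) \<subseteq> Poly_Mapping.keys m"
        by (auto simp: in_keys_iff lk simp del: One_nat_def)
      then have "Poly_Mapping.keys (m - Poly_Mapping.single i 1) \<subseteq> insert i {..<i}"
        using keys[OF m] by blast
      then have "monomial_value \<eta> (m - Poly_Mapping.single i 1) =
          \<eta> i ^ (Poly_Mapping.lookup m i - 1) * (\<Prod>j<i. \<eta> j ^ Poly_Mapping.lookup m j)"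
        by (subst mv) (auto simp: lk simp del: One_nat_def intro!: prod.cong)
      then show ?thesis by (simp add: c_def mult_ac)
    qed
    ultimately show ?thesis
      unfolding partial_deriv_def mpol_eval_sum mpol_eval_single
      by (simp only: pderiv_monom poly_sum poly_monom cong: sum.cong)
  qed
  ultimately show ?thesis by blast
qed

lemma partial_deriv_not_occurs:
  assumes "\<not> occurs_in j f"
  shows "partial_deriv j f = 0"
  unfolding partial_deriv_def
proof (rule sum.neutral, rule ballI)
  fix m assume "m \<in> Poly_Mapping.keys f"
  then have "Poly_Mapping.lookup m j = 0"
    using assms by (auto simp: occurs_in_def in_keys_iff)
  then show "Poly_Mapping.single (m - Poly_Mapping.single j 1)
      (of_nat (Poly_Mapping.lookup m j) * Poly_Mapping.lookup f m) = 0" by simp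
qed

section \<open>The embedding into the algebraic closure\<close>

lemma is_subfield_to_ac_image: "is_subfield K \<Longrightarrow> is_subfield (to_ac ` K)"
  unfolding is_subfield_def is_subring_def
  by (auto simp flip: to_ac_1 to_ac_diff to_ac_mult to_ac_inverse)

lemma is_subfield_UNIV: "is_subfield UNIV"
  by (simp add: is_subfield_def is_subring_def)

lemma is_subfield_to_ac_vimage: "is_subfield A \<Longrightarrow> is_subfield {x. to_ac x \<in> A}"
  unfolding is_subfield_def is_subring_def by simp

lemma field_adjoin_to_ac: "to_ac ` field_adjoin K S \<subseteq> field_adjoin (to_ac ` K) (to_ac ` S)"
proof -
  let ?E = "field_adjoin (to_ac ` K) (to_ac ` S)"
  have "is_subfield {x. to_ac x \<in> ?E}"
    by (intro is_subfield_to_ac_vimage is_subfield_field_adjoin)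
  then have "field_adjoin K S \<subseteq> {x. to_ac x \<in> ?E}"
    using field_adjoin_incl[of "to_ac ` K" "to_ac ` S"] by (intro field_adjoin_least) auto
  then show ?thesis by auto
qed

lemma field_adjoin_to_ac_eq: "to_ac ` field_adjoin K S = field_adjoin (to_ac ` K) (to_ac ` S)"
  using field_adjoin_to_ac field_adjoin_incl[of K S]
  by (intro equalityI field_adjoin_least is_subfield_to_ac_image is_subfield_field_adjoin) auto

lemma poly_map_to_ac: "poly (map_poly to_ac p) (to_ac x) = to_ac (poly p x)"
  by (induction p) (auto simp: map_poly_pCons)

lemma pderiv_map_to_ac: "pderiv (map_poly to_ac p) = map_poly to_ac (pderiv p)"
  by (intro poly_eqI) (simp add: coeff_pderiv coeff_map_poly)

lemma map_to_ac_poly_over: "p \<in> poly_over R \<Longrightarrow> map_poly to_ac p \<in> poly_over (to_ac ` R)"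
  by (auto simp: poly_over_def coeff_map_poly)

lemma algebraic_over_to_ac:
  assumes "algebraic_over_subfield L x"
  shows "algebraic_over_subfield (to_ac ` L) (to_ac x)"
proof -
  obtain p where p: "p \<in> poly_over L" "p \<noteq> 0" "poly p x = 0"
    using assms by (auto simp: algebraic_over_subfield_iff)
  have "map_poly to_ac p \<noteq> 0"
    using p(2) by (simp add: poly_eq_iff coeff_map_poly)
  then show ?thesis
    using map_to_ac_poly_over[OF p(1)] p(3) poly_map_to_ac[of p x]
    by (auto simp: algebraic_over_subfield_iff)
qed

section \<open>Simple roots of the residue polynomial\<close>

text \<open>Induction along the Horner scheme involves no division by factorials, so the remainder
  stays in \<open>R\<close> in every characteristic.\<close>

lemma poly_taylor_remainder:
  assumes R: "is_subring R" and p: "p \<in> poly_over R" and y: "y \<in> R" and d: "d \<in> R"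
  shows "\<exists>r\<in>R. poly p (y + d) = poly p y + d * poly (pderiv p) y + d ^ 2 * r"
  using p
proof (induction p)
  case 0
  show ?case by (intro bexI[of _ 0]) (auto intro: subring_zero[OF R])
next
  case (pCons a p)
  then have p: "p \<in> poly_over R" by (simp add: poly_over_pCons)
  then obtain r where r: "r \<in> R" "poly p (y + d) = poly p y + d * poly (pderiv p) y + d ^ 2 * r"
    using pCons.IH by blast
  have "poly (pderiv p) y \<in> R"
    by (intro poly_in_subring[OF R] poly_over_pderiv[OF R] p y)
  then have "poly (pderiv p) y + (y + d) * r \<in> R"
    using r y d by (intro subring_add[OF R] subring_mult[OF R])
  moreover have "poly (pCons a p) (y + d) = poly (pCons a p) y + d * poly (pderiv (pCons a p)) y +
      d ^ 2 * (poly (pderiv p) y + (y + d) * r)"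
    unfolding poly_pCons r(2) pderiv_pCons poly_add by (simp add: algebra_simps power2_eq_square)
  ultimately show ?case by blast
qed

text \<open>Uniqueness half of Hensel's lemma. If \<open>d = z - y\<close> were nonzero, dividing
  the Taylor expansion of \<open>p\<close> at \<open>y\<close> by \<open>d\<close> would exhibit the
  derivative as a multiple of \<open>d\<close>, and its residue would be 0.\<close>

lemma place_simple_root_unique:
  assumes Q: "place_on N Q" and p: "p \<in> poly_over (valuation_ring N Q)"
    and y: "y \<in> valuation_ring N Q" and z: "z \<in> N"
    and roots: "poly p y = 0" "poly p z = 0"
    and simple: "Q (poly (pderiv p) y) \<noteq> Some 0" and close: "Q (z - y) = Some 0"
  shows "z = y"
proof (rule ccontr)
  assume "z \<noteq> y"
  define d where "d = z - y"
  note R = is_subring_valuation_ring[OF Q]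
  have O_iff: "x \<in> valuation_ring N Q \<longleftrightarrow> x \<in> N \<and> (\<exists>a. Q x = Some a)" for x
    by (auto simp: valuation_ring_def)
  have "d \<in> N"
    unfolding d_def using y z O_iff by (intro subring_diff[OF subfield_subring[OF place_subfield[OF Q]]]) auto
  then have d: "d \<in> valuation_ring N Q" "Q d = Some 0"
    using close by (auto simp: d_def O_iff)
  obtain r where r: "r \<in> valuation_ring N Q"
    "poly p (y + d) = poly p y + d * poly (pderiv p) y + d ^ 2 * r"
    using poly_taylor_remainder[OF R p y d(1)] by blast
  have D: "poly (pderiv p) y \<in> valuation_ring N Q"
    by (intro poly_in_subring[OF R] poly_over_pderiv[OF R] p y)
  have "d * (poly (pderiv p) y + d * r) = 0"
    using r(2) roots by (simp add: d_def algebra_simps power2_eq_square)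
  then have zero: "poly (pderiv p) y = - (d * r)"
    using \<open>z \<noteq> y\<close> by (simp add: d_def eq_neg_iff_add_eq_0)
  obtain c where "Q r = Some c" using r(1) by (auto simp: O_iff)
  then have "Q (d * r) = Some 0"
    using place_mult[OF Q, of d r 0 c] d r(1) by (auto simp: O_iff)
  then have "Q (poly (pderiv p) y) = Some 0"
    unfolding zero using place_uminus[OF Q, of "d * r" 0] subring_mult[OF R d(1) r(1)]
    by (auto simp: O_iff)
  with simple show False by contradiction
qed

lemma place_prod_zero:
  assumes P: "place_on UNIV P" and "finite I" and i: "i \<in> I" "P (f i) = Some 0"
    and O: "\<And>i. i \<in> I \<Longrightarrow> P (f i) \<noteq> None"
  shows "P (prod f I) = Some 0"
proof -
  have "prod f (I - {i}) \<in> valuation_ring UNIV P"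
    using O by (intro subring_prod[OF is_subring_valuation_ring[OF P]]) (auto simp: valuation_ring_def)
  then obtain a where "P (prod f (I - {i})) = Some a"
    by (auto simp: valuation_ring_def)
  then have "P (f i * prod f (I - {i})) = Some (0 * a)"
    using i(2) by (intro place_mult[OF P]) auto
  then show ?thesis using assms(2) i(1) by (simp add: prod.remove)
qed

section \<open>Weakly uniformizable places\<close>

text \<open>The determinant of the lower triangular Jacobian is the product of its diagonal entries.
  Each entry is finite at \<open>P\<close>, being the value of the derivative of a univariate
  polynomial over the valuation ring, so one factor with residue 0 would give the product residue
  0.\<close>

lemma jacobian_diagonal:
  assumes P: "place_on UNIV P"
    and f: "\<And>i. i < n \<Longrightarrow> f i \<in> mpol_over R {..<n}"
    and R: "is_subring R" "R \<subseteq> valuation_ring UNIV P"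
    and \<eta>: "\<And>i. i < n \<Longrightarrow> \<eta> i \<in> valuation_ring UNIV P"
    and occ: "\<And>i j. i < j \<Longrightarrow> j < n \<Longrightarrow> \<not> occurs_in j (f i)"
    and det: "P (det (jacobian_at n f \<eta>)) \<noteq> Some 0" and i: "i < n"
  shows "P (mpol_eval (partial_deriv i (f i)) \<eta>) \<noteq> Some 0"
proof
  assume *: "P (mpol_eval (partial_deriv i (f i)) \<eta>) = Some 0"
  have "det (jacobian_at n f \<eta>) = prod_list (diag_mat (jacobian_at n f \<eta>))"
    by (rule det_lower_triangular[of n])
      (auto simp: jacobian_at_def partial_deriv_not_occurs occ mpol_eval_zero)
  also have "\<dots> = (\<Prod>i\<in>{0..<n}. mpol_eval (partial_deriv i (f i)) \<eta>)"
    by (simp add: prod_list_diag_prod jacobian_at_def)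
  finally have eq: "det (jacobian_at n f \<eta>) = (\<Prod>i\<in>{0..<n}. mpol_eval (partial_deriv i (f i)) \<eta>)" .
  have O: "is_subring (valuation_ring UNIV P)" by (rule is_subring_valuation_ring[OF P])
  have "P (\<Prod>i\<in>{0..<n}. mpol_eval (partial_deriv i (f i)) \<eta>) = Some 0"
  proof (rule place_prod_zero[OF P, where i = i])
    fix k assume "k \<in> {0..<n}"
    then have k: "k < n" by simp
    have "f k \<in> mpol_over (valuation_ring UNIV P) {..<n}"
      using f[OF k] R(2) by (auto simp: mpol_over_def)
    from mpol_univariate[where \<eta> = \<eta>, OF O this k]
    obtain g where g: "g \<in> poly_over (valuation_ring UNIV P)"
      "poly (pderiv g) (\<eta> k) = mpol_eval (partial_deriv k (f k)) \<eta>"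
      using occ \<eta> k by auto
    have "poly (pderiv g) (\<eta> k) \<in> valuation_ring UNIV P"
      by (intro poly_in_subring[OF O] poly_over_pderiv[OF O] g \<eta> k)
    then show "P (mpol_eval (partial_deriv k (f k)) \<eta>) \<noteq> None"
      using g(2) by (simp add: valuation_ring_def)
  qed (use i * in auto)
  with det eq show False by simp
qed

text \<open>The tower of simple extensions by simple roots that remains of a weak uniformization
  after the triangular system has been solved variable by variable.\<close>

definition simple_root_tower ::
  "'a::field set \<Rightarrow> ('a \<Rightarrow> 'k::field option) \<Rightarrow> nat \<Rightarrow> (nat \<Rightarrow> 'a) \<Rightarrow> (nat \<Rightarrow> 'a poly) \<Rightarrow> bool" where
  "simple_root_tower L P n \<eta> g \<longleftrightarrow>
     field_adjoin L (\<eta> ` {..<n}) = UNIV \<and>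
     (\<forall>i<n. P (\<eta> i) \<noteq> None \<and>
        g i \<in> poly_over (valuation_ring UNIV P \<inter> field_adjoin L (\<eta> ` {..<i})) \<and>
        poly (g i) (\<eta> i) = 0 \<and> P (poly (pderiv (g i)) (\<eta> i)) \<noteq> Some 0)"

lemma weakly_uniformizable_tower:
  assumes P: "place_on UNIV P" and wu: "weakly_uniformizable K P"
  shows "\<exists>T n \<eta> g. transcendence_basis K T \<and> simple_root_tower (field_adjoin K T) P n \<eta> g"
proof -
  let ?O = "valuation_ring UNIV P"
  obtain T n \<eta> f where T: "T \<subseteq> ?O" "transcendence_basis K T"
    and \<eta>: "\<eta> ` {..<n} \<subseteq> ?O"
    and f: "\<And>i. i < n \<Longrightarrow> f i \<in> mpol_over (ring_adjoin (valuation_ring K P) T) {..<n}"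
    and gen: "field_adjoin K (T \<union> \<eta> ` {..<n}) = UNIV"
    and occ: "\<And>i j. i < j \<Longrightarrow> j < n \<Longrightarrow> \<not> occurs_in j (f i)"
    and root: "\<And>i. i < n \<Longrightarrow> mpol_eval (f i) \<eta> = 0"
    and det: "P (det (jacobian_at n f \<eta>)) \<noteq> Some 0"
    using wu unfolding weakly_uniformizable_def
    by (elim exE conjE) (rule that; simp)
  define L where "L = field_adjoin K T"
  define R where "R = ring_adjoin (valuation_ring K P) T"
  have O: "is_subring ?O" by (rule is_subring_valuation_ring[OF P])
  have R: "is_subring R" unfolding R_def by (rule is_subring_ring_adjoin)
  have L: "is_subfield L" unfolding L_def by (rule is_subfield_field_adjoin)
  have RO: "R \<subseteq> ?O"
    unfolding R_def using T(1) by (intro ring_adjoin_least O) (auto simp: valuation_ring_def)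
  have RL: "R \<subseteq> L"
    unfolding R_def using field_adjoin_incl[of K T]
    by (intro ring_adjoin_least subfield_subring[OF L]) (auto simp: valuation_ring_def L_def)
  have "\<exists>g. g \<in> poly_over (?O \<inter> field_adjoin L (\<eta> ` {..<i})) \<and>
        poly g (\<eta> i) = 0 \<and> P (poly (pderiv g) (\<eta> i)) \<noteq> Some 0" if i: "i < n" for i
  proof -
    \<comment> \<open>Both conditions on the coefficients matter later: finiteness for the
      comparison of roots, and membership in the lower stage so that an automorphism fixes them by
      induction.\<close>
    let ?A = "?O \<inter> field_adjoin L (\<eta> ` {..<i})"
    have E: "is_subring (field_adjoin L (\<eta> ` {..<i}))"
      by (intro subfield_subring is_subfield_field_adjoin)
    have A: "is_subring ?A"
      using O E by (simp add: is_subring_def)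
    have incl: "L \<union> \<eta> ` {..<i} \<subseteq> field_adjoin L (\<eta> ` {..<i})" by (rule field_adjoin_incl)
    have fA: "f i \<in> mpol_over ?A {..<n}"
      using f[OF i] RO RL incl unfolding mpol_over_def R_def[symmetric] by blast
    have "\<eta> j \<in> ?A" if "j < i" for j
      using \<eta> incl that i by auto
    then obtain g where g: "g \<in> poly_over ?A" "poly g (\<eta> i) = mpol_eval (f i) \<eta>"
      "poly (pderiv g) (\<eta> i) = mpol_eval (partial_deriv i (f i)) \<eta>"
      using mpol_univariate[where \<eta> = \<eta>, OF A fA i] occ by blast
    have "P (mpol_eval (partial_deriv i (f i)) \<eta>) \<noteq> Some 0"
      using f \<eta> by (intro jacobian_diagonal[OF P _ R RO _ occ det i]) (auto simp: R_def)
    then show ?thesis using g root[OF i] by auto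
  qed
  then obtain g where g: "\<And>i. i < n \<Longrightarrow> g i \<in> poly_over (?O \<inter> field_adjoin L (\<eta> ` {..<i})) \<and>
        poly (g i) (\<eta> i) = 0 \<and> P (poly (pderiv (g i)) (\<eta> i)) \<noteq> Some 0"
    by metis
  have "simple_root_tower L P n \<eta> g"
    using g \<eta> gen unfolding simple_root_tower_def L_def field_adjoin_Un
    by (auto simp: valuation_ring_def)
  then show ?thesis using T(2) unfolding L_def by blast
qed

text \<open>An element whose value is not \<open>Some 0\<close> is nonzero, so each generator is a
  simple root and separable over the stage below; transitivity climbs the tower.\<close>

lemma simple_root_tower_frobenius_disjoint:
  assumes P: "place_on UNIV P" and L: "is_subfield L" and tower: "simple_root_tower L P n \<eta> g"
  shows "frobenius_disjoint (to_ac ` L) (range to_ac)"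
proof -
  have "frobenius_disjoint (to_ac ` L) (to_ac ` field_adjoin L (\<eta> ` {..<i}))" if "i \<le> n" for i
    using that
  proof (induction i)
    case 0
    then show ?case by (simp add: field_adjoin_empty[OF L] frobenius_disjoint_refl)
  next
    case (Suc i)
    let ?E = "field_adjoin L (\<eta> ` {..<i})"
    have i: "i < n" using Suc.prems by simp
    have E: "is_subfield (to_ac ` ?E)"
      by (intro is_subfield_to_ac_image is_subfield_field_adjoin)
    have g: "g i \<in> poly_over ?E" "poly (g i) (\<eta> i) = 0" "poly (pderiv (g i)) (\<eta> i) \<noteq> 0"
      using tower i place_zero[OF P] unfolding simple_root_tower_def by (auto simp: poly_over_def)
    have "separable_over_subfield (to_ac ` ?E) (to_ac (\<eta> i))"
      using map_to_ac_poly_over[OF g(1)] g(2,3)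
      by (intro separable_over_subfieldI[OF E, of "map_poly to_ac (g i)"])
        (simp_all add: pderiv_map_to_ac poly_map_to_ac)
    then have "frobenius_disjoint (to_ac ` ?E) (field_adjoin (to_ac ` ?E) {to_ac (\<eta> i)})"
      by (rule frobenius_disjoint_separable[OF E])
    also have "field_adjoin (to_ac ` ?E) {to_ac (\<eta> i)} = to_ac ` field_adjoin ?E {\<eta> i}"
      by (simp add: field_adjoin_to_ac_eq)
    also have "field_adjoin ?E {\<eta> i} = field_adjoin L (\<eta> ` {..<Suc i})"
      by (simp add: lessThan_Suc flip: field_adjoin_Un)
    finally show ?case
      using Suc.IH i field_adjoin_incl[of L "\<eta> ` {..<i}"]
      by (auto intro: frobenius_disjoint_trans[of "to_ac ` L" "to_ac ` ?E"])
  qed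
  from this[of n] show ?thesis
    using tower by (simp add: simple_root_tower_def)
qed

text \<open>In \<open>frobenius_disjoint\<close> the coefficients come from the large field and the
  independent elements are \<open>q\<close>-th roots. In \<open>linearly_disjoint\<close> these
  roles are exchanged, and \<open>frobenius_disjoint_family\<close> mediates between the
  two.\<close>

lemma separable_extension_if_frobenius_disjoint:
  fixes K :: "'a::field set"
  assumes K: "is_subfield K" and disj: "frobenius_disjoint (to_ac ` K) (range to_ac)"
  shows "separable_extension K"
  unfolding separable_extension_def linearly_disjoint_def
proof (intro allI impI, elim conjE)
  fix E S assume E: "purely_inseparable (to_ac ` K) E"
    and fin: "finite S" and S: "S \<subseteq> range to_ac" and indep: "lin_indep_over (to_ac ` K) S"
  have K': "is_subfield (to_ac ` K)" by (rule is_subfield_to_ac_image[OF K])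
  show "lin_indep_over E S"
    unfolding lin_indep_over_def
  proof (intro allI impI, elim conjE)
    fix c assume c: "\<forall>x\<in>S. c x \<in> E" and sum0: "(\<Sum>x\<in>S. c x * x) = 0"
    have "\<forall>x\<in>S. \<exists>n. c x ^ (max 1 CHAR('a alg_closure) ^ n) \<in> to_ac ` K"
      using c E by (auto simp: purely_inseparable_def)
    then obtain N where N: "\<And>x. x \<in> S \<Longrightarrow> c x ^ (max 1 CHAR('a alg_closure) ^ N x) \<in> to_ac ` K"
      by metis
    \<comment> \<open>A common exponent for all coefficients; any upper bound of the
      \<open>N x\<close> would do.\<close>
    define n where "n = (\<Sum>x\<in>S. N x)"
    have n: "c x ^ (max 1 CHAR('a alg_closure) ^ n) \<in> to_ac ` K" if "x \<in> S" for x
    proof -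
      have "N x \<le> n" unfolding n_def using fin that by (intro member_le_sum) auto
      then have "c x ^ (max 1 CHAR('a alg_closure) ^ n) =
          (c x ^ (max 1 CHAR('a alg_closure) ^ N x)) ^ (max 1 CHAR('a alg_closure) ^ (n - N x))"
        by (simp only: flip: power_mult power_add) simp
      then show ?thesis using N[OF that] subring_power[OF subfield_subring[OF K']] by metis
    qed
    show "\<forall>x\<in>S. c x = 0"
    proof (rule frobenius_disjoint_family[where I = S and x = "\<lambda>x. x" and c = c and n = n,
          OF K' _ _ disj fin])
      show "is_subring (range to_ac)"
        by (intro subfield_subring is_subfield_to_ac_image is_subfield_UNIV)
      show "\<forall>x\<in>S. e x = 0"
        if "\<And>x. x \<in> S \<Longrightarrow> e x \<in> to_ac ` K" "(\<Sum>x\<in>S. e x * x) = 0" for e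
        using lin_indep_overD[OF indep that] by blast
      show "c x ^ (max 1 CHAR('a alg_closure) ^ n) \<in> to_ac ` K" if "x \<in> S" for x
        by (rule n[OF that])
    qed (use S sum0 in auto)
  qed
qed

section \<open>Rigidity of the tower\<close>

context
  fixes N L :: "'b::field set" and \<sigma> :: "'b \<Rightarrow> 'b"
  assumes N: "is_subfield N" and \<sigma>: "\<sigma> \<in> galois_group N L"
begin

lemma galois_add: "x \<in> N \<Longrightarrow> y \<in> N \<Longrightarrow> \<sigma> (x + y) = \<sigma> x + \<sigma> y"
  and galois_mult: "x \<in> N \<Longrightarrow> y \<in> N \<Longrightarrow> \<sigma> (x * y) = \<sigma> x * \<sigma> y"
  and galois_fixed: "x \<in> L \<Longrightarrow> \<sigma> x = x"
  and galois_mem: "x \<in> N \<Longrightarrow> \<sigma> x \<in> N"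
  and galois_inj: "x \<in> N \<Longrightarrow> y \<in> N \<Longrightarrow> \<sigma> x = \<sigma> y \<Longrightarrow> x = y"
  using \<sigma> by (auto simp: galois_group_def bij_betw_def inj_on_def)

lemma galois_zero: "\<sigma> 0 = 0"
  using galois_add[of 0 0] subring_zero[OF subfield_subring[OF N]] by (metis add_0_right add_left_cancel)

lemma galois_diff: "x \<in> N \<Longrightarrow> y \<in> N \<Longrightarrow> \<sigma> (x - y) = \<sigma> x - \<sigma> y"
  using galois_add[of "x - y" y] subring_diff[OF subfield_subring[OF N], of x y] by (simp add: eq_diff_eq)

lemma galois_one: "\<sigma> 1 = 1"
proof -
  have 1: "1 \<in> N" and 0: "0 \<in> N"
    by (rule subring_one[OF subfield_subring[OF N]], rule subring_zero[OF subfield_subring[OF N]])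
  have "\<sigma> 1 * \<sigma> 1 = \<sigma> 1" using galois_mult[OF 1 1] by simp
  moreover have "\<sigma> 1 \<noteq> 0" using galois_inj[OF 1 0] galois_zero by auto
  ultimately show ?thesis by simp
qed

lemma galois_inverse:
  assumes x: "x \<in> N"
  shows "\<sigma> (inverse x) = inverse (\<sigma> x)"
proof (cases "x = 0")
  case False
  have "\<sigma> x * \<sigma> (inverse x) = 1"
    using galois_mult[OF x subfield_inverse[OF N x]] False galois_one by simp
  then show ?thesis by (metis inverse_unique)
qed (simp add: galois_zero)

lemma galois_poly:
  assumes "p \<in> poly_over N" "\<And>i. \<sigma> (poly.coeff p i) = poly.coeff p i" "x \<in> N"
  shows "\<sigma> (poly p x) = poly p (\<sigma> x)"
  using assms(1,2)
proof (induction p)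
  case 0
  then show ?case by (simp add: galois_zero)
next
  case (pCons a p)
  note R = subfield_subring[OF N]
  have p: "p \<in> poly_over N" "a \<in> N" using pCons.prems(1) by (auto simp: poly_over_pCons)
  have "\<sigma> a = a" using pCons.prems(2)[of 0] by simp
  moreover have "\<sigma> (poly.coeff p i) = poly.coeff p i" for i
    using pCons.prems(2)[of "Suc i"] by simp
  ultimately show ?case
    using pCons.IH p assms(3) poly_in_subring[OF R p(1) assms(3)]
    by (simp add: galois_add galois_mult subring_mult[OF R])
qed

lemma is_subfield_fixed: "is_subfield {x \<in> N. \<sigma> x = x}"
  unfolding is_subfield_def is_subring_def
  using subring_closed[OF subfield_subring[OF N]] subfield_inverse[OF N]
  by (auto simp: galois_one galois_diff galois_mult galois_inverse)

end

text \<open>An automorphism that fixes \<open>L\<close> and acts trivially on the residues of \<open>\<F>\<close> fixes the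
  generators one after the other: \<open>\<eta>\<^sub>i\<close> and its image are roots of the same polynomial with the
  same residue, which is a simple root of the residue polynomial.\<close>

lemma simple_root_tower_fixed:
  fixes P :: "'a::field \<Rightarrow> 'k::field option" and Q :: "'a alg_closure \<Rightarrow> 'k alg_closure option"
  assumes P: "place_on UNIV P" and L: "is_subfield L" and tower: "simple_root_tower L P n \<eta> g"
    and Q: "place_on N Q" "place_extends Q P" and N: "range to_ac \<subseteq> N"
    and \<sigma>: "\<sigma> \<in> galois_group N (to_ac ` L)"
    and close: "\<And>x. P x \<noteq> None \<Longrightarrow> Q (\<sigma> (to_ac x) - to_ac x) = Some 0"
  shows "\<sigma> (to_ac x) = to_ac x"
proof -
  note NF = place_subfield[OF Q(1)]
  have QP: "Q (to_ac x) = map_option to_ac (P x)" for x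
    using Q(2) by (simp add: place_extends_def)
  define E where "E = {x. \<sigma> (to_ac x) = to_ac x}"
  have "E = {x. to_ac x \<in> {y \<in> N. \<sigma> y = y}}"
    using N by (auto simp: E_def)
  then have "is_subfield E"
    using is_subfield_to_ac_vimage[OF is_subfield_fixed[OF NF \<sigma>]] by simp
  moreover have "L \<subseteq> E"
    unfolding E_def using galois_fixed[OF NF \<sigma>] by auto
  moreover have "\<eta> ` {..<i} \<subseteq> E" if "i \<le> n" for i
    using that
  proof (induction i)
    case (Suc i)
    then have i: "i < n" and IH: "\<eta> ` {..<i} \<subseteq> E" by auto
    have g: "g i \<in> poly_over (valuation_ring UNIV P \<inter> field_adjoin L (\<eta> ` {..<i}))"
      "poly (g i) (\<eta> i) = 0" "P (poly (pderiv (g i)) (\<eta> i)) \<noteq> Some 0" "P (\<eta> i) \<noteq> None"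
      using tower i unfolding simple_root_tower_def by auto
    let ?g = "map_poly to_ac (g i)" and ?y = "to_ac (\<eta> i)"
    have LE: "field_adjoin L (\<eta> ` {..<i}) \<subseteq> E"
      using \<open>is_subfield E\<close> \<open>L \<subseteq> E\<close> IH by (intro field_adjoin_least)
    have yN: "?y \<in> N" using N by auto
    have gN: "?g \<in> poly_over N" using N by (auto simp: poly_over_def coeff_map_poly)
    have root: "poly ?g ?y = 0" using g(2) by (simp add: poly_map_to_ac)
    have fix_g: "\<sigma> (poly.coeff ?g k) = poly.coeff ?g k" for k
      using g(1) LE by (auto simp: poly_over_def coeff_map_poly E_def)
    have "\<sigma> ?y = ?y"
    proof (rule place_simple_root_unique[OF Q(1) _ _ _ root])
      show "?g \<in> poly_over (valuation_ring N Q)"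
        using g(1) N by (auto simp: poly_over_def coeff_map_poly valuation_ring_def QP)
      show "?y \<in> valuation_ring N Q" using yN g(4) by (simp add: valuation_ring_def QP)
      show "\<sigma> ?y \<in> N" by (rule galois_mem[OF NF \<sigma> yN])
      show "poly ?g (\<sigma> ?y) = 0"
        using galois_poly[OF NF \<sigma> gN fix_g yN] root galois_zero[OF NF \<sigma>] by simp
      show "Q (poly (pderiv ?g) ?y) \<noteq> Some 0"
        using g(3) by (auto simp: pderiv_map_to_ac poly_map_to_ac QP)
      show "Q (\<sigma> ?y - ?y) = Some 0" by (rule close[OF g(4)])
    qed
    then show ?case using IH by (simp add: lessThan_Suc E_def)
  qed simp
  ultimately have "field_adjoin L (\<eta> ` {..<n}) \<subseteq> E" by (intro field_adjoin_least) auto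
  then show ?thesis using tower by (auto simp: simple_root_tower_def E_def)
qed

text \<open>An automorphism preserving the valuation ring preserves its nonunits: if
  \<open>\<sigma> w\<close> were a unit, its inverse \<open>\<sigma> (1/w)\<close> would be the
  image of an element of the valuation ring, which by injectivity is \<open>1/w\<close>.\<close>

lemma decomposition_group_maximal_ideal:
  assumes Q: "place_on N Q" and \<sigma>: "\<sigma> \<in> decomposition_group N L Q"
    and w: "w \<in> N" "Q w = Some 0"
  shows "Q (\<sigma> w) = Some 0"
proof (cases "w = 0")
  case True
  have "\<sigma> \<in> galois_group N L" using \<sigma> by (simp add: decomposition_group_def)
  then show ?thesis using True galois_zero[OF place_subfield[OF Q], of \<sigma> L] w by simp
next
  case False
  note NF = place_subfield[OF Q]
  have gal: "\<sigma> \<in> galois_group N L" and img: "\<sigma> ` valuation_ring N Q = valuation_ring N Q"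
    using \<sigma> by (auto simp: decomposition_group_def)
  have wN: "inverse w \<in> N" by (rule subfield_inverse[OF NF w(1)])
  have sN: "\<sigma> w \<in> N" by (rule galois_mem[OF NF gal w(1)])
  have "\<sigma> w \<in> valuation_ring N Q" using img w by (auto simp: valuation_ring_def)
  then obtain b where b: "Q (\<sigma> w) = Some b" by (auto simp: valuation_ring_def)
  have "b = 0"
  proof (rule ccontr)
    assume "b \<noteq> 0"
    have "inverse (\<sigma> w) \<in> N" by (rule subfield_inverse[OF NF sN])
    \<comment> \<open>Otherwise the inverse of this element, which is \<open>\<sigma> w\<close>,
      would have value 0 instead of \<open>b\<close>.\<close>
    moreover have "Q (inverse (\<sigma> w)) \<noteq> None"
      using place_inverse[OF Q \<open>inverse (\<sigma> w) \<in> N\<close>] b \<open>b \<noteq> 0\<close> by auto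
    ultimately have "inverse (\<sigma> w) \<in> \<sigma> ` valuation_ring N Q"
      using img by (simp add: valuation_ring_def)
    then obtain v where v: "v \<in> valuation_ring N Q" "\<sigma> (inverse w) = \<sigma> v"
      using galois_inverse[OF NF gal w(1)] by auto
    then have "v = inverse w"
      using galois_inj[OF NF gal wN, of v] by (simp add: valuation_ring_def)
    then obtain c where "Q (inverse w) = Some c" using v(1) by (auto simp: valuation_ring_def)
    from place_mult[OF Q w(1) wN w(2) this] have "Q 1 = Some 0" using False by simp
    then show False using place_one[OF Q] by simp
  qed
  with b show ?thesis by simp
qed

theorem theorem1p15:
  fixes K :: "'a::field set" and P :: "'a \<Rightarrow> 'k::field option"
  assumes "is_subfield K"
    and "finitely_generated_over K"
    and "place_on UNIV P"
    and "weakly_uniformizable K P"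
  shows "inertially_generated K P
    \<and> separable_extension K
    \<and> (\<forall>\<iota>. place_identity_on \<iota> K P \<and> residue_field UNIV P = \<iota> ` K \<longrightarrow>
          henselian_generated K P)"
proof -
  note K = assms(1) and P = assms(3)
  obtain T n \<eta> g where T: "transcendence_basis K T"
    and tower: "simple_root_tower (field_adjoin K T) P n \<eta> g"
    using weakly_uniformizable_tower[OF P assms(4)] by blast
  define L where "L = field_adjoin K T"
  note tower = tower[folded L_def]
  have L: "is_subfield L" unfolding L_def by (rule is_subfield_field_adjoin)
  have KL: "K \<subseteq> L" using field_adjoin_incl[of K T] by (auto simp: L_def)
  have disj: "frobenius_disjoint (to_ac ` L) (range to_ac)"
    by (rule simple_root_tower_frobenius_disjoint[OF P L tower])
  define N where "N = sep_closure (to_ac ` L)"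
  have NF: "is_subfield N"
    unfolding N_def by (intro is_subfield_sep_closure is_subfield_to_ac_image L)
  \<comment> \<open>The fixed fields below are subsets of \<open>N\<close>, so this is part of the
    claim. It is the converse criterion, applied to elements that are algebraic over
    \<open>K(T)\<close> because \<open>T\<close> is a transcendence basis.\<close>
  have N: "range to_ac \<subseteq> N"
  proof
    fix y assume y: "y \<in> range (to_ac :: 'a \<Rightarrow> _)"
    then obtain x where x: "y = to_ac x" by auto
    have "algebraic_over_subfield L x"
      using T by (simp add: transcendence_basis_def L_def)
    then have "separable_over_subfield (to_ac ` L) y"
      unfolding x
      by (intro separable_if_frobenius_disjoint[OF is_subfield_to_ac_image[OF L] _ _ disj]
          algebraic_over_to_ac subfield_subring is_subfield_to_ac_image is_subfield_UNIV) auto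
    then show "y \<in> N" by (simp add: N_def sep_closure_def)
  qed
  obtain Q where "place_on UNIV Q" and QP: "place_extends Q P"
    using place_extension_alg_closure[OF P] by blast
  \<comment> \<open>The place axioms restrict to subfields, and \<open>N\<close> contains the whole
    field, so agreement with \<open>P\<close> is kept.\<close>
  then have Q: "place_on N Q"
    using NF unfolding place_on_def valuation_ring_def by auto
  have Q_to_ac: "Q (to_ac x) = map_option to_ac (P x)" for x
    using QP by (simp add: place_extends_def)
  have "range to_ac \<subseteq> fixed_field N (inertia_group N (to_ac ` L) Q)"
  proof
    fix y assume "y \<in> range (to_ac :: 'a \<Rightarrow> _)"
    then obtain x where x: "y = to_ac x" by auto
    have "\<sigma> y = y" if \<sigma>: "\<sigma> \<in> inertia_group N (to_ac ` L) Q" for \<sigma>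
      unfolding x
    proof (rule simple_root_tower_fixed[OF P L tower Q QP N])
      show "\<sigma> \<in> galois_group N (to_ac ` L)" using \<sigma> by (simp add: inertia_group_def)
      fix z assume "P z \<noteq> None"
      then have "to_ac z \<in> valuation_ring N Q"
        using N by (auto simp: valuation_ring_def Q_to_ac)
      then show "Q (\<sigma> (to_ac z) - to_ac z) = Some 0"
        using \<sigma> by (simp add: inertia_group_def)
    qed
    then show "y \<in> fixed_field N (inertia_group N (to_ac ` L) Q)"
      using N x by (auto simp: fixed_field_def)
  qed
  then have "inertially_generated K P"
    unfolding inertially_generated_def absolute_inertia_field_def
    using T Q QP by (intro exI[of _ T] exI[of _ Q]) (auto simp: N_def L_def)
  moreover have "separable_extension K"
  proof (rule separable_extension_if_frobenius_disjoint[OF K])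
    have "frobenius_disjoint (to_ac ` K) (to_ac ` L)"
      unfolding L_def using T
      by (intro frobenius_disjoint_transcendental[OF K]) (simp add: transcendence_basis_def)
    then show "frobenius_disjoint (to_ac ` K) (range to_ac)"
      using disj image_mono[OF KL] by (rule frobenius_disjoint_trans)
  qed
  moreover have "henselian_generated K P"
    if \<iota>: "place_identity_on \<iota> K P" "residue_field UNIV P = \<iota> ` K" for \<iota>
  proof -
    have "range to_ac \<subseteq> fixed_field N (decomposition_group N (to_ac ` L) Q)"
    proof
      fix y assume "y \<in> range (to_ac :: 'a \<Rightarrow> _)"
      then obtain x where x: "y = to_ac x" by auto
      have "\<sigma> y = y" if \<sigma>: "\<sigma> \<in> decomposition_group N (to_ac ` L) Q" for \<sigma>
        unfolding x
      proof (rule simple_root_tower_fixed[OF P L tower Q QP N])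
        show gal: "\<sigma> \<in> galois_group N (to_ac ` L)" using \<sigma> by (simp add: decomposition_group_def)
        fix z assume "P z \<noteq> None"
        then obtain a where a: "P z = Some a" by auto
        then have "a \<in> residue_field UNIV P"
          by (force simp: residue_field_def residue_def valuation_ring_def)
        \<comment> \<open>As the residue field is the image of \<open>K\<close>, the residue of
          \<open>z\<close> is attained by some \<open>c\<close> in \<open>K\<close>, which every
          automorphism over \<open>K(T)\<close> fixes. Thus \<open>z - c\<close> lies in the maximal
          ideal, which the decomposition group preserves.\<close>
        then obtain c where c: "c \<in> K" "a = \<iota> c" using \<iota>(2) by auto
        have "P c = Some a" using \<iota>(1) c by (simp add: place_identity_on_def)
        then have "P (z - c) = Some 0" using place_diff[OF P _ _ a, of c a] by simp
        then have "Q (\<sigma> (to_ac (z - c))) = Some 0"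
          using N by (intro decomposition_group_maximal_ideal[OF Q \<sigma>]) (auto simp: Q_to_ac simp del: to_ac_diff)
        moreover have "\<sigma> (to_ac (z - c)) = \<sigma> (to_ac z) - to_ac c"
        proof -
          have "to_ac z \<in> N" "to_ac c \<in> N" "to_ac c \<in> to_ac ` L"
            using N c KL by auto
          then show ?thesis
            by (simp add: galois_diff[OF NF gal] galois_fixed[OF NF gal])
        qed
        moreover have "Q (to_ac (z - c)) = Some 0"
          using \<open>P (z - c) = Some 0\<close> by (simp add: Q_to_ac del: to_ac_diff)
        ultimately have "Q (\<sigma> (to_ac z) - to_ac c) = Some 0" "Q (to_ac z - to_ac c) = Some 0" by simp_all
        \<comment> \<open>Both \<open>z\<close> and its image are congruent to \<open>c\<close>,
          hence to each other.\<close>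
        then have "Q ((\<sigma> (to_ac z) - to_ac c) - (to_ac z - to_ac c)) = Some (0 - 0)"
          using galois_mem[OF NF gal, of "to_ac z"] N
          by (intro place_diff[OF Q] subring_diff[OF subfield_subring[OF NF]]) auto
        then show "Q (\<sigma> (to_ac z) - to_ac z) = Some 0" by simp
      qed
      then show "y \<in> fixed_field N (decomposition_group N (to_ac ` L) Q)"
        using N x by (auto simp: fixed_field_def)
    qed
    then show ?thesis
      unfolding henselian_generated_def henselization_def
      using T Q QP by (intro exI[of _ T] exI[of _ Q]) (auto simp: N_def L_def)
  qed
  ultimately show ?thesis by blast
qed

end
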